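(* Let $k\ge 0$ and $n\ge 2k+1$ be integers, and let $G$ be a nearly balanced bipartite graph on $2n-1$ vertices with minimum degree $\delta(G)\ge k$. (1) If $k\ge 1$ and $\rho(\widehat{G})\le\rho(\widehat{S_n^k})$, then $G$ is traceable unless $G\in\mathcal{S}_n^k$. (2) If $k=0$, $n\ge 2$ and $\rho(\widehat{G})\le\rho(\widehat{T_n^0})$, then $G$ is traceable unless $G\in\mathcal{S}_n^1\cup\{T_n^0\}$ (where $\mathcal{S}_n^1$ is read as empty if $n=2$).
   Context: Graphs are finite and simple. A bipartite graph comes with a fixed bipartition $\{X,Y\}$ (parts may be empty); it is nearly balanced if the sizes of its two parts differ by exactly $1$ (the roles of the two parts may be interchanged), so here the parts have sizes $n$ and $n-1$. A graph is traceable if it contains a spanning path (Hamilton path). $\rho(G)$ is the spectral radius (largest eigenvalue of the adjacency matrix). The quasi-complement $\widehat{G}$ of a bipartite graph $G$ with bipartition $\{X,Y\}$ is the bipartite graph with the same vertex set and bipartition such that, for $x\in X$ and $y\in Y$, $xy\in E(\widehat G)$ if and only if $xy\notin E(G)$. Equality of graphs and membership in a family are up to isomorphism of bipartite graphs (possibly interchanging the two parts). $\mathcal{G}_{m,n}$ is the set of bipartite graphs with parts of sizes $|X|=m$, $|Y|=n$; $K_{m,n}$ and $\varPhi_{m,n}$ are the complete and the edgeless members of $\mathcal{G}_{m,n}$, respectively. For bipartite graphs $G_1,G_2$ with bipartitions $\{X_1,Y_1\}$, $\{X_2,Y_2\}$, $G_1\sqcup G_2$ is the graph obtained from the disjoint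 union $G_1\cup G_2$ by adding all edges between $X_1$ and $Y_2$ and all edges between $Y_1$ and $X_2$ (its parts are $X_1\cup X_2$ and $Y_1\cup Y_2$). Define $S_n^k=K_{k,n-k-1}\sqcup\varPhi_{n-k,k}$ and $\mathcal{S}_n^k=\{H\sqcup\varPhi_{k,n-k}: H\in\mathcal{G}_{n-k-1,k}\}$ for $1\le k\le (n-1)/2$, and $T_n^k=K_{k,n-k-1}\sqcup\varPhi_{n-k-1,k+1}$ for $0\le k\le n/2-1$. *)

theory Defs
  imports "Jordan_Normal_Form.Spectral_Radius"
begin

text \<open>Finite simple bipartite graphs with a fixed bipartition; an edge is an unordered pair of
  vertices. Either part may be empty.\<close>

record 'a bigraph =
  partX :: "'a set"
  partY :: "'a set"
  edges :: "'a set set"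

definition verts :: "'a bigraph \<Rightarrow> 'a set" where
  "verts G = partX G \<union> partY G"

definition all_cross :: "'a set \<Rightarrow> 'a set \<Rightarrow> 'a set set" where
  "all_cross A B = {{a, b} | a b. a \<in> A \<and> b \<in> B}"

definition bipartite_graph :: "'a bigraph \<Rightarrow> bool" where
  "bipartite_graph G \<longleftrightarrow>
     finite (partX G) \<and> finite (partY G) \<and> partX G \<inter> partY G = {} \<and>
     edges G \<subseteq> all_cross (partX G) (partY G)"

definition nearly_balanced :: "'a bigraph \<Rightarrow> bool" where
  "nearly_balanced G \<longleftrightarrow>
     card (partX G) = card (partY G) + 1 \<or> card (partY G) = card (partX G) + 1"

definition adjacent :: "'a bigraph \<Rightarrow> 'a \<Rightarrow> 'a \<Rightarrow> bool" where
  "adjacent G u v \<longleftrightarrow> {u, v} \<in> edges G"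

definition vertex_degree :: "'a bigraph \<Rightarrow> 'a \<Rightarrow> nat" where
  "vertex_degree G v = card {u \<in> verts G. adjacent G v u}"

definition min_degree :: "'a bigraph \<Rightarrow> nat" where
  "min_degree G = Min (vertex_degree G ` verts G)"

definition traceable :: "'a bigraph \<Rightarrow> bool" where
  "traceable G \<longleftrightarrow> (\<exists>p. distinct p \<and> set p = verts G \<and> successively (adjacent G) p)"

text \<open>The adjacency matrix is taken with respect to an arbitrary enumeration of the vertices;
  its spectrum does not depend on the enumeration.\<close>

definition vertex_enum :: "'a bigraph \<Rightarrow> 'a list" where
  "vertex_enum G = (SOME vs. distinct vs \<and> set vs = verts G)"

definition adjacency_matrix :: "'a bigraph \<Rightarrow> real mat" where
  "adjacency_matrix G = (let vs = vertex_enum G in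
     mat (length vs) (length vs) (\<lambda>(i, j). if adjacent G (vs ! i) (vs ! j) then 1 else 0))"

text \<open>The maximum is taken over the real eigenvalues, which are all eigenvalues since the matrix
  is symmetric; it is meaningful for graphs with at least one vertex.\<close>

definition graph_spectral_radius :: "'a bigraph \<Rightarrow> real" where
  "graph_spectral_radius G = Max (spectrum (adjacency_matrix G))"

definition quasi_complement :: "'a bigraph \<Rightarrow> 'a bigraph" where
  "quasi_complement G =
     \<lparr>partX = partX G, partY = partY G, edges = all_cross (partX G) (partY G) - edges G\<rparr>"

text \<open>Isomorphisms respect the bipartition but may interchange the two parts.\<close>

definition isomorphic :: "'a bigraph \<Rightarrow> 'b bigraph \<Rightarrow> bool" where
  "isomorphic G H \<longleftrightarrow> (\<exists>f. bij_betw f (verts G) (verts H) \<and>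
     (f ` partX G = partX H \<and> f ` partY G = partY H \<or>
      f ` partX G = partY H \<and> f ` partY G = partX H) \<and>
     (\<forall>u\<in>verts G. \<forall>v\<in>verts G. adjacent G u v \<longleftrightarrow> adjacent H (f u) (f v)))"

definition in_family :: "'a bigraph \<Rightarrow> 'b bigraph set \<Rightarrow> bool" where
  "in_family G \<F> \<longleftrightarrow> (\<exists>F\<in>\<F>. isomorphic G F)"

text \<open>Vertices are natural numbers in the graphs below, which loses no generality
  up to isomorphism.\<close>

definition bigraphs :: "nat \<Rightarrow> nat \<Rightarrow> nat bigraph set" where
  "bigraphs m n = {G. bipartite_graph G \<and> card (partX G) = m \<and> card (partY G) = n}"

definition complete_bigraph :: "nat \<Rightarrow> nat \<Rightarrow> nat bigraph" where
  "complete_bigraph m n =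
     \<lparr>partX = {..<m}, partY = {m..<m + n}, edges = all_cross {..<m} {m..<m + n}\<rparr>"

definition edgeless_bigraph :: "nat \<Rightarrow> nat \<Rightarrow> nat bigraph" where
  "edgeless_bigraph m n = \<lparr>partX = {..<m}, partY = {m..<m + n}, edges = {}\<rparr>"

definition bip_join :: "'a bigraph \<Rightarrow> 'b bigraph \<Rightarrow> ('a + 'b) bigraph" where
  "bip_join G H =
     \<lparr>partX = Inl ` partX G \<union> Inr ` partX H,
      partY = Inl ` partY G \<union> Inr ` partY H,
      edges = (\<lambda>e. Inl ` e) ` edges G \<union> (\<lambda>e. Inr ` e) ` edges H
        \<union> all_cross (Inl ` partX G) (Inr ` partY H)
        \<union> all_cross (Inl ` partY G) (Inr ` partX H)\<rparr>"

text \<open>The graphs $S_n^k$ (for $1 \le k \le (n-1)/2$) and $T_n^k$ (for $0 \le k \le n/2 - 1$);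
  outside these ranges of parameters the values are junk.\<close>

definition S_graph :: "nat \<Rightarrow> nat \<Rightarrow> (nat + nat) bigraph" where
  "S_graph n k = bip_join (complete_bigraph k (n - k - 1)) (edgeless_bigraph (n - k) k)"

definition T_graph :: "nat \<Rightarrow> nat \<Rightarrow> (nat + nat) bigraph" where
  "T_graph n k = bip_join (complete_bigraph k (n - k - 1)) (edgeless_bigraph (n - k - 1) (k + 1))"

text \<open>The family $\mathcal{S}_n^k$; it is empty unless $1 \le k \le (n-1)/2$.\<close>

definition S_family :: "nat \<Rightarrow> nat \<Rightarrow> (nat + nat) bigraph set" where
  "S_family n k =
     {bip_join H (edgeless_bigraph k (n - k)) | H.
        1 \<le> k \<and> 2 * k + 1 \<le> n \<and> H \<in> bigraphs (n - k - 1) k}"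

end

theory Submission
  imports Defs "HOL-Analysis.Function_Topology"
begin

text \<open>Let the parts have sizes $n$ and $n - 1$ and enlarge $G$ to an edge-maximal nontraceable graph.
  A nonadjacent pair $x, y$ of the latter is joined by a Hamilton path once the small part gets a
  dominating vertex, so crossing edges show that the degrees of $x$ and $y$ in the quasi-complement
  add up to at least $n$; with the bounds from $\delta(G) \ge k$ their product is at least
  $c = k(n - k)$ (or $n - 1$ if $k = 0$). The test vector $v \mapsto \sqrt{d(v)}$ then gives
  $\rho(\widehat G) \ge \sqrt c$, and equality forces the product to be $c$ for all nonadjacent
  pairs. For $k \ge 1$ the crossing argument becomes exact, and comparing the crossing patterns of
  the rotated Hamilton paths yields a block $K_{n-k,k}$ of the quasi-complement; for $k = 0$ a star
  $K_{n-1,1}$ or $K_{1,n-1}$ is found at once. Since $\rho(\widehat G)$ does not exceed the spectral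
  radius $\sqrt c$ of this block, perturbing its eigenvector shows that it is a component of
  $\widehat G$, which is the claimed structure of $G$.\<close>

section \<open>Rotations of Hamilton paths in balanced bipartite graphs\<close>

text \<open>Let a and b be the degrees in the quasi-complement of a nonadjacent pair, a on the
  larger side. For k \<ge> 1, equality in the product bound still allows two extremes, a = k and a =
  n - k. The dominating vertex separates them: it raises every degree on the larger side by one, so
  a \<le> n - k - 1 and only a = k, b = n - k survives. Every nonadjacent pair of the maximal graph
  then has degree sum exactly n. This makes the crossing pattern of each of its Hamilton paths
  rigid, and therefore also that of every rotated path, which is what allows patterns to be
  compared. For k = 0 the dominating vertex supplies degree one on the larger side, so the product
  bound runs with 1 in place of k but without the spare unit. Both extremes survive, and the second
  one is the origin of the exception \<open>T_graph n 0\<close>. Enlarging the graph does no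
  spectral harm: its quasi-complement shrinks, and the test vector is nonnegative, so the bound for
  the larger quasi-complement applies. The two sides have different types so that the balancing
  vertex can be adjoined by \<open>option\<close> on one side only.\<close>

text \<open>A path visits $\xi(0), \eta(0), \xi(1), \eta(1), \dots, \xi(n-1), \eta(n-1)$; a single edge
  counts as a Hamilton cycle when $n = 1$.\<close>

definition ham_path ::
  "nat \<Rightarrow> 'a set \<Rightarrow> 'b set \<Rightarrow> ('a \<times> 'b) set \<Rightarrow> (nat \<Rightarrow> 'a) \<Rightarrow> (nat \<Rightarrow> 'b) \<Rightarrow> bool" where
  "ham_path n X Y E \<xi> \<eta> \<longleftrightarrow> bij_betw \<xi> {..<n} X \<and> bij_betw \<eta> {..<n} Y \<and>
     (\<forall>i<n. (\<xi> i, \<eta> i) \<in> E) \<and> (\<forall>i. Suc i < n \<longrightarrow> (\<xi> (Suc i), \<eta> i) \<in> E)"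

definition hamiltonian :: "nat \<Rightarrow> 'a set \<Rightarrow> 'b set \<Rightarrow> ('a \<times> 'b) set \<Rightarrow> bool" where
  "hamiltonian n X Y E \<longleftrightarrow> (\<exists>\<xi> \<eta>. ham_path n X Y E \<xi> \<eta> \<and> (\<xi> 0, \<eta> (n - 1)) \<in> E)"

lemma hamiltonianI:
  "ham_path n X Y E \<xi> \<eta> \<Longrightarrow> (\<xi> 0, \<eta> (n - 1)) \<in> E \<Longrightarrow> hamiltonian n X Y E"
  by (auto simp: hamiltonian_def)

text \<open>Each rotation below reverses a stretch of indices, hence acts as an involution on them;
  this settles bijectivity of the rotated enumerations.\<close>

lemma bij_betw_precomp_involution:
  assumes "bij_betw f {..<n} A" and "\<And>i. i < n \<Longrightarrow> \<pi> i < n" and "\<And>i. i < n \<Longrightarrow> \<pi> (\<pi> i) = i"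
  shows "bij_betw (\<lambda>i. f (\<pi> i)) {..<n} A"
proof -
  have "bij_betw \<pi> {..<n} {..<n}"
    by (rule bij_betw_byWitness[where f' = \<pi>]) (use assms in auto)
  from bij_betw_trans[OF this assms(1)] show ?thesis by (simp add: o_def)
qed

text \<open>Posa rotation: run up to \<xi>(i), jump to \<eta>(n-1) and return backwards, ending in
  \<eta>(i). The reversed indices are i+1..n-1 for \<xi> but i..n-1 for \<eta>, hence the two
  different offsets.\<close>

lemma ham_path_rotate_end:
  assumes p: "ham_path n X Y E \<xi> \<eta>" and i: "i < n" "(\<xi> i, \<eta> (n - 1)) \<in> E"
  shows "ham_path n X Y E (\<lambda>j. \<xi> (if j \<le> i then j else n + i - j))
           (\<lambda>j. \<eta> (if j < i then j else n - 1 + i - j))" (is "ham_path n X Y E ?\<xi> ?\<eta>")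
  unfolding ham_path_def
proof (intro conjI allI impI)
  have E1: "(\<xi> j, \<eta> j) \<in> E" if "j < n" for j using p that by (auto simp: ham_path_def)
  have E2: "(\<xi> (Suc j), \<eta> j) \<in> E" if "Suc j < n" for j using p that by (auto simp: ham_path_def)
  show "bij_betw ?\<xi> {..<n} X"
    by (rule bij_betw_precomp_involution) (use p i in \<open>auto simp: ham_path_def\<close>)
  show "bij_betw ?\<eta> {..<n} Y"
    by (rule bij_betw_precomp_involution) (use p i in \<open>auto simp: ham_path_def\<close>)
  fix j
  show "(?\<xi> j, ?\<eta> j) \<in> E" if "j < n"
  proof -
    consider "j < i" | "j = i" | "i < j" by linarith
    then show ?thesis
    proof cases
      case 3
      then have "n + i - j = Suc (n - 1 + i - j)" using that by linarith
      then show ?thesis using E2[of "n - 1 + i - j"] 3 that i by auto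
    qed (use E1 that i in auto)
  qed
  show "(?\<xi> (Suc j), ?\<eta> j) \<in> E" if "Suc j < n"
  proof (cases "j < i")
    case False
    have "n + i - Suc j = n - 1 + i - j" using that by linarith
    then show ?thesis using E1[of "n - 1 + i - j"] False that i by auto
  qed (use E2 that i in auto)
qed

text \<open>The mirror image of the previous rotation: the stretch from \<xi>(0) to \<xi>(i) is
  reversed, so that \<xi>(i) becomes the first vertex and the end is kept.\<close>

lemma ham_path_rotate_start:
  assumes p: "ham_path n X Y E \<xi> \<eta>" and i: "i < n" "(\<xi> 0, \<eta> i) \<in> E"
  shows "ham_path n X Y E (\<lambda>j. \<xi> (if j \<le> i then i - j else j))
           (\<lambda>j. \<eta> (if j < i then i - 1 - j else j))" (is "ham_path n X Y E ?\<xi> ?\<eta>")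
  unfolding ham_path_def
proof (intro conjI allI impI)
  have E1: "(\<xi> j, \<eta> j) \<in> E" if "j < n" for j using p that by (auto simp: ham_path_def)
  have E2: "(\<xi> (Suc j), \<eta> j) \<in> E" if "Suc j < n" for j using p that by (auto simp: ham_path_def)
  show "bij_betw ?\<xi> {..<n} X"
    by (rule bij_betw_precomp_involution) (use p i in \<open>auto simp: ham_path_def\<close>)
  show "bij_betw ?\<eta> {..<n} Y"
    by (rule bij_betw_precomp_involution) (use p i in \<open>auto simp: ham_path_def\<close>)
  fix j
  show "(?\<xi> j, ?\<eta> j) \<in> E" if "j < n"
  proof -
    consider "j < i" | "j = i" | "i < j" by linarith
    then show ?thesis
    proof cases
      case 1
      then have "i - j = Suc (i - 1 - j)" using that by linarith
      then show ?thesis using E2[of "i - 1 - j"] 1 that i by auto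
    qed (use E1 that i in auto)
  qed
  show "(?\<xi> (Suc j), ?\<eta> j) \<in> E" if "Suc j < n"
  proof (cases "j < i")
    case True
    have "i - Suc j = i - 1 - j" by linarith
    then show ?thesis using E1[of "i - 1 - j"] True that i by auto
  qed (use E2 that i in auto)
qed

lemma ham_path_in_range:
  assumes "ham_path n X Y E \<xi> \<eta>" "i < n"
  shows "\<xi> i \<in> X" "\<eta> i \<in> Y"
  using assms by (auto simp: ham_path_def bij_betw_def)

lemma ham_path_card_right:
  assumes "ham_path n X Y E \<xi> \<eta>"
  shows "card {y \<in> Y. P y} = card {j. j < n \<and> P (\<eta> j)}"
proof -
  have b: "bij_betw \<eta> {..<n} Y" using assms by (simp add: ham_path_def)
  have "{y \<in> Y. P y} = \<eta> ` {j. j < n \<and> P (\<eta> j)}"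
    using b by (auto simp: bij_betw_def)
  moreover have "inj_on \<eta> {j. j < n \<and> P (\<eta> j)}"
    using b by (auto simp: bij_betw_def inj_on_def)
  ultimately show ?thesis by (simp add: card_image)
qed

lemma ham_path_card_left:
  assumes "ham_path n X Y E \<xi> \<eta>"
  shows "card {x \<in> X. P x} = card {j. j < n \<and> P (\<xi> j)}"
proof -
  have b: "bij_betw \<xi> {..<n} X" using assms by (simp add: ham_path_def)
  have "{x \<in> X. P x} = \<xi> ` {j. j < n \<and> P (\<xi> j)}"
    using b by (auto simp: bij_betw_def)
  moreover have "inj_on \<xi> {j. j < n \<and> P (\<xi> j)}"
    using b by (auto simp: bij_betw_def inj_on_def)
  ultimately show ?thesis by (simp add: card_image)
qed

section \<open>Crossing edges of a Hamilton path in a nonhamiltonian graph\<close>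

lemma nonhamiltonian_crossing:
  assumes nh: "\<not> hamiltonian n X Y E" and p: "ham_path n X Y E \<xi> \<eta>"
    and i: "i < n" "(\<xi> i, \<eta> (n - 1)) \<in> E"
  shows "(\<xi> 0, \<eta> i) \<notin> E"
proof
  assume *: "(\<xi> 0, \<eta> i) \<in> E"
  have "\<not> n - 1 < i" using i by linarith
  \<comment> \<open>The rotated path ends in \<eta>(i), so the assumed edge closes it.\<close>
  with * have "hamiltonian n X Y E"
    by (intro hamiltonianI[OF ham_path_rotate_end[OF p i]]) simp
  with nh show False ..
qed

text \<open>Rotating the end at i makes \<eta>(i) the last vertex and leaves everything before
  \<xi>(i) in place, so the plain crossing condition can be read off at position j.\<close>

lemma nonhamiltonian_crossing_rotated:
  assumes nh: "\<not> hamiltonian n X Y E" and p: "ham_path n X Y E \<xi> \<eta>"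
    and i: "i < n" "(\<xi> i, \<eta> (n - 1)) \<in> E" and j: "j < i" "(\<xi> j, \<eta> i) \<in> E"
  shows "(\<xi> 0, \<eta> j) \<notin> E"
proof -
  define \<xi>' where "\<xi>' l = \<xi> (if l \<le> i then l else n + i - l)" for l
  define \<eta>' where "\<eta>' l = \<eta> (if l < i then l else n - 1 + i - l)" for l
  have p': "ham_path n X Y E \<xi>' \<eta>'"
    using ham_path_rotate_end[OF p i] unfolding \<xi>'_def[abs_def] \<eta>'_def[abs_def] .
  have "\<not> n - 1 < i" "j \<le> i" "j < n" "n - 1 + i - (n - 1) = i" using i j by auto
  then have "\<xi>' 0 = \<xi> 0" "\<xi>' j = \<xi> j" "\<eta>' j = \<eta> j" "\<eta>' (n - 1) = \<eta> i"
    unfolding \<xi>'_def \<eta>'_def using j by (simp_all only: if_False if_True le0)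
  then show ?thesis using nonhamiltonian_crossing[OF nh p', of j] j \<open>j < n\<close> by simp
qed

text \<open>By the crossing condition no index serves both as neighbour of the first vertex and as
  neighbour of the last one, and there are only n indices.\<close>

lemma nonhamiltonian_degree_sum:
  assumes nh: "\<not> hamiltonian n X Y E" and p: "ham_path n X Y E \<xi> \<eta>"
  shows "card {y \<in> Y. (\<xi> 0, y) \<in> E} + card {x \<in> X. (x, \<eta> (n - 1)) \<in> E} \<le> n"
proof -
  let ?I = "{j. j < n \<and> (\<xi> 0, \<eta> j) \<in> E}" and ?J = "{j. j < n \<and> (\<xi> j, \<eta> (n - 1)) \<in> E}"
  have "card ?I + card ?J = card (?I \<union> ?J)"
    using nonhamiltonian_crossing[OF nh p] by (intro card_Un_disjoint[symmetric]) auto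
  also have "\<dots> \<le> card {..<n}" by (intro card_mono) auto
  finally show ?thesis
    unfolding ham_path_card_right[OF p] ham_path_card_left[OF p] by simp
qed

lemma nonhamiltonian_crossing_iff:
  assumes nh: "\<not> hamiltonian n X Y E" and p: "ham_path n X Y E \<xi> \<eta>"
    and deg: "card {y \<in> Y. (\<xi> 0, y) \<in> E} + card {x \<in> X. (x, \<eta> (n - 1)) \<in> E} = n"
    and i: "i < n"
  shows "(\<xi> 0, \<eta> i) \<in> E \<longleftrightarrow> (\<xi> i, \<eta> (n - 1)) \<notin> E"
proof -
  let ?I = "{j. j < n \<and> (\<xi> 0, \<eta> j) \<in> E}" and ?J = "{j. j < n \<and> (\<xi> j, \<eta> (n - 1)) \<in> E}"
  have "card (?I \<union> ?J) = card ?I + card ?J"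
    using nonhamiltonian_crossing[OF nh p] by (intro card_Un_disjoint) auto
  also have "\<dots> = card {..<n}" 
    using deg unfolding ham_path_card_right[OF p] ham_path_card_left[OF p] by simp
  finally have "?I \<union> ?J = {..<n}" by (intro card_subset_eq) auto
  then show ?thesis using i nonhamiltonian_crossing[OF nh p i] by auto
qed

section \<open>Rotating a Hamilton cycle\<close>

lemma ham_cycle_flip_start:
  assumes p: "ham_path n X Y E \<xi> \<eta>" and c: "(\<xi> 0, \<eta> (n - 1)) \<in> E" and n: "0 < n"
  shows "ham_path n X Y E (\<lambda>j. \<xi> (if j \<le> n - 1 then n - 1 - j else j))
           (\<lambda>j. \<eta> (if j < n - 1 then n - 1 - 1 - j else j))"
  using ham_path_rotate_start[OF p, of "n - 1"] c n by simp

lemma ham_cycle_flip_end: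
  assumes p: "ham_path n X Y E \<xi> \<eta>" and c: "(\<xi> 0, \<eta> (n - 1)) \<in> E" and n: "0 < n"
  shows "ham_path n X Y E (\<lambda>j. \<xi> (if j = 0 then 0 else n - j)) (\<lambda>j. \<eta> (n - 1 - j))"
  using ham_path_rotate_end[OF p, of 0] c n by (simp cong: if_cong)

text \<open>The two flips read the cycle backwards from different points; their composition is a
  shift by one index, which is iterated m times.\<close>

lemma ham_cycle_rotate:
  assumes "ham_path n X Y E \<xi> \<eta>" and "(\<xi> 0, \<eta> (n - 1)) \<in> E" and "m < n"
  shows "\<exists>\<xi>' \<eta>'. ham_path n X Y E \<xi>' \<eta>' \<and> (\<xi>' 0, \<eta>' (n - 1)) \<in> E \<and> \<xi>' 0 = \<xi> m \<and> \<eta>' 0 = \<eta> m"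
  using assms
proof (induction m arbitrary: \<xi> \<eta>)
  case 0
  then show ?case by blast
next
  case (Suc m)
  then have n: "0 < n" "0 < n - 1" by auto
  let ?\<xi> = "\<lambda>j. \<xi> (if j = 0 then 0 else n - j)" and ?\<eta> = "\<lambda>j. \<eta> (n - 1 - j)"
  have 1: "ham_path n X Y E ?\<xi> ?\<eta>" by (rule ham_cycle_flip_end) (use Suc.prems n in auto)
  have 2: "(?\<xi> 0, ?\<eta> (n - 1)) \<in> E" using Suc.prems n by (auto simp: ham_path_def)
  define \<xi>' where "\<xi>' j = ?\<xi> (if j \<le> n - 1 then n - 1 - j else j)" for j
  define \<eta>' where "\<eta>' j = ?\<eta> (if j < n - 1 then n - 1 - 1 - j else j)" for j
  have 3: "ham_path n X Y E \<xi>' \<eta>'"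
    using ham_cycle_flip_start[OF 1 2 n(1)] unfolding \<xi>'_def[abs_def] \<eta>'_def[abs_def] .
  have "(\<xi> (Suc 0), \<eta> 0) \<in> E" using Suc.prems n by (auto simp: ham_path_def)
  moreover have "\<xi>' 0 = \<xi> (Suc 0)" "\<eta>' (n - 1) = \<eta> 0" using n by (simp_all add: \<xi>'_def \<eta>'_def)
  ultimately have 4: "(\<xi>' 0, \<eta>' (n - 1)) \<in> E" by simp
  have m: "m < n" using Suc.prems by simp
  have "m < n - 1" "m \<le> n - 1" "n - 1 - m \<noteq> 0" "n - (n - 1 - m) = Suc m" "n - 1 - (n - 1 - 1 - m) = Suc m"
    using Suc.prems by auto
  then have "\<xi>' m = \<xi> (Suc m)" "\<eta>' m = \<eta> (Suc m)" by (simp_all add: \<xi>'_def \<eta>'_def)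
  with Suc.IH[OF 3 4 m] show ?case by simp
qed

text \<open>A pair with equal indices is shifted to the front, and reading the cycle backwards from
  its first vertex makes it the closing edge. A pair \<xi>(m+1), \<eta>(m) gets equal indices after
  one flip of the start, which reduces it to the first case.\<close>

lemma ham_cycle_edge_closing:
  assumes p: "ham_path n X Y E \<xi> \<eta>" and c: "(\<xi> 0, \<eta> (n - 1)) \<in> E"
    and e: "(\<exists>m<n. x = \<xi> m \<and> y = \<eta> m) \<or> (\<exists>m. Suc m < n \<and> x = \<xi> (Suc m) \<and> y = \<eta> m)"
  shows "\<exists>\<xi>' \<eta>'. ham_path n X Y E \<xi>' \<eta>' \<and> \<xi>' 0 = x \<and> \<eta>' (n - 1) = y"
proof -
  have n: "0 < n" using e by auto
  have pair: "\<exists>\<xi>' \<eta>'. ham_path n X Y E \<xi>' \<eta>' \<and> \<xi>' 0 = x \<and> \<eta>' (n - 1) = y"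
    if p: "ham_path n X Y E \<xi> \<eta>" and c: "(\<xi> 0, \<eta> (n - 1)) \<in> E" and m: "m < n" "x = \<xi> m" "y = \<eta> m"
    for \<xi> \<eta> m
  proof -
    obtain \<xi>' \<eta>' where "ham_path n X Y E \<xi>' \<eta>'" "(\<xi>' 0, \<eta>' (n - 1)) \<in> E" "\<xi>' 0 = x" "\<eta>' 0 = y"
      using ham_cycle_rotate[OF p c m(1)] m by auto
    note this(3,4) and ham_cycle_flip_end[OF this(1,2) n]
    then show ?thesis
      by (intro exI[of _ "\<lambda>j. \<xi>' (if j = 0 then 0 else n - j)"] exI[of _ "\<lambda>j. \<eta>' (n - 1 - j)"]) simp
  qed
  from e show ?thesis
  proof
    assume "\<exists>m<n. x = \<xi> m \<and> y = \<eta> m"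
    then show ?thesis using pair[OF p c] by blast
  next
    assume "\<exists>m. Suc m < n \<and> x = \<xi> (Suc m) \<and> y = \<eta> m"
    then obtain m where m: "Suc m < n" "x = \<xi> (Suc m)" "y = \<eta> m" by blast
    have i: "n - 1 - (n - 1 - Suc m) = Suc m" "n - 1 - 1 - (n - 1 - Suc m) = m" "n - 1 - Suc m < n - 1"
      using m(1) by auto
    have "(\<xi> (n - 1), \<eta> (n - 1)) \<in> E" using p n by (auto simp: ham_path_def)
    then show ?thesis
      by (intro pair[OF ham_cycle_flip_start[OF p c n], of "n - 1 - Suc m"]) (use n m i in auto)
  qed
qed

text \<open>A missing pair added to a maximal graph creates a Hamilton cycle, which has to use this
  pair. Turned so that the pair is the closing edge, the cycle leaves the required path when the
  pair is dropped again.\<close>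

lemma maximal_nonhamiltonian:
  assumes fin: "finite X" "finite Y" and n: "2 \<le> n" and E: "E \<subseteq> X \<times> Y" "\<not> hamiltonian n X Y E"
  obtains M where "E \<subseteq> M" "M \<subseteq> X \<times> Y" "\<not> hamiltonian n X Y M"
    "\<And>x y. x \<in> X \<Longrightarrow> y \<in> Y \<Longrightarrow> (x, y) \<notin> M \<Longrightarrow>
       \<exists>\<xi> \<eta>. ham_path n X Y M \<xi> \<eta> \<and> \<xi> 0 = x \<and> \<eta> (n - 1) = y"
proof -
  define \<M> where "\<M> = {M. M \<subseteq> X \<times> Y \<and> \<not> hamiltonian n X Y M}"
  have "finite \<M>" unfolding \<M>_def by (rule finite_subset[of _ "Pow (X \<times> Y)"]) (use fin in auto)
  moreover have "E \<in> \<M>" using E by (simp add: \<M>_def)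
  ultimately obtain M where M': "M \<in> \<M>" "E \<subseteq> M" and max: "\<forall>M'\<in>\<M>. M \<subseteq> M' \<longrightarrow> M = M'"
    using finite_has_maximal2[of \<M> E] by blast
  then have M: "M \<subseteq> X \<times> Y" "\<not> hamiltonian n X Y M" "E \<subseteq> M" by (simp_all add: \<M>_def)
  have "\<exists>\<xi> \<eta>. ham_path n X Y M \<xi> \<eta> \<and> \<xi> 0 = x \<and> \<eta> (n - 1) = y"
    if xy: "x \<in> X" "y \<in> Y" "(x, y) \<notin> M" for x y
  proof -
    have "insert (x, y) M \<notin> \<M>" using max xy by blast
    moreover have "insert (x, y) M \<subseteq> X \<times> Y" using M xy by blast
    ultimately have "hamiltonian n X Y (insert (x, y) M)" by (simp add: \<M>_def)
    then obtain \<xi> \<eta> where p: "ham_path n X Y (insert (x, y) M) \<xi> \<eta>"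
      and c: "(\<xi> 0, \<eta> (n - 1)) \<in> insert (x, y) M" unfolding hamiltonian_def by blast
    have "\<exists>\<xi> \<eta>. ham_path n X Y (insert (x, y) M) \<xi> \<eta> \<and> \<xi> 0 = x \<and> \<eta> (n - 1) = y"
    proof (cases "(\<xi> 0, \<eta> (n - 1)) = (x, y)")
      case True
      then show ?thesis using p by blast
    next
      case False
      show ?thesis
      proof (rule ccontr)
        assume "\<not> ?thesis"
        then have no: "\<not> ((\<exists>m<n. x = \<xi> m \<and> y = \<eta> m) \<or> (\<exists>m. Suc m < n \<and> x = \<xi> (Suc m) \<and> y = \<eta> m))"
          using ham_cycle_edge_closing[OF p c, of x y] by blast
        have "ham_path n X Y M \<xi> \<eta>"
          unfolding ham_path_def
        proof (intro conjI allI impI)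
          show "bij_betw \<xi> {..<n} X" "bij_betw \<eta> {..<n} Y" using p by (simp_all add: ham_path_def)
          show "(\<xi> i, \<eta> i) \<in> M" if "i < n" for i
            using p no that unfolding ham_path_def by blast
          show "(\<xi> (Suc i), \<eta> i) \<in> M" if "Suc i < n" for i
            using p no that unfolding ham_path_def by blast
        qed
        moreover have "(\<xi> 0, \<eta> (n - 1)) \<in> M" using False c by blast
        ultimately have "hamiltonian n X Y M" by (rule hamiltonianI)
        then show False using M by simp
      qed
    qed
    then obtain \<xi> \<eta> where p: "ham_path n X Y (insert (x, y) M) \<xi> \<eta>" and e: "\<xi> 0 = x" "\<eta> (n - 1) = y"
      by blast
    \<comment> \<open>The closing pair must not also occur inside the path. Being of the form
      \<xi>(i), \<eta>(i) would force i = 0 and i = n - 1, which n \<ge> 2 excludes.\<close>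
    have inj: "inj_on \<xi> {..<n}" "inj_on \<eta> {..<n}" using p by (auto simp: ham_path_def bij_betw_def)
    have "(\<xi> i, \<eta> i) \<noteq> (x, y)" if "i < n" for i
    proof
      assume "(\<xi> i, \<eta> i) = (x, y)"
      then have "i = 0" "i = n - 1"
        using inj_onD[OF inj(1), of i 0] inj_onD[OF inj(2), of i "n - 1"] e that n by simp_all
      with n show False by simp
    qed
    moreover have "(\<xi> (Suc i), \<eta> i) \<noteq> (x, y)" if "Suc i < n" for i
      using inj_onD[OF inj(1), of "Suc i" 0] e that by auto
    ultimately have "ham_path n X Y M \<xi> \<eta>" using p by (auto simp: ham_path_def)
    with e show ?thesis by blast
  qed
  then show ?thesis using M by (intro that[of M])
qed

section \<open>Rigidity of the crossing pattern when all degree sums equal n\<close>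

text \<open>Rotating the end of the path to $\eta(i)$ or its start to $\xi(j)$ decides in two ways whether
  $\xi(j)$ and $\eta(i)$ are adjacent.\<close>

lemma crossing_exchange:
  assumes nh: "\<not> hamiltonian n X Y E" and p: "ham_path n X Y E \<xi> \<eta>"
    and deg: "\<forall>x\<in>X. \<forall>y\<in>Y. (x, y) \<notin> E \<longrightarrow>
      card {y \<in> Y. (x, y) \<in> E} + card {x \<in> X. (x, y) \<in> E} = n"
    and ij: "i < j" "j < n" "(\<xi> i, \<eta> (n - 1)) \<in> E" "(\<xi> j, \<eta> (n - 1)) \<notin> E"
  shows "(\<xi> (j - 1), \<eta> (n - 1)) \<in> E \<longleftrightarrow> (\<xi> (Suc i), \<eta> (n - 1)) \<notin> E"
proof -
  \<comment> \<open>In a nonhamiltonian graph the ends of any Hamilton path are nonadjacent, so the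
    exact dichotomy is available for all rotated paths as well.\<close>
  have crossing: "(\<xi> 0, \<eta> l) \<in> E \<longleftrightarrow> (\<xi> l, \<eta> (n - 1)) \<notin> E"
    if "ham_path n X Y E \<xi> \<eta>" "l < n" for \<xi> \<eta> l
  proof (rule nonhamiltonian_crossing_iff[OF nh that(1) _ that(2)])
    have "\<xi> 0 \<in> X" "\<eta> (n - 1) \<in> Y" using ham_path_in_range[OF that(1)] that(2) by auto
    moreover have "(\<xi> 0, \<eta> (n - 1)) \<notin> E" using nh that(1) by (auto simp: hamiltonian_def)
    ultimately show "card {y \<in> Y. (\<xi> 0, y) \<in> E} + card {x \<in> X. (x, \<eta> (n - 1)) \<in> E} = n"
      using deg by blast
  qed
  \<comment> \<open>With the end rotated to \<eta>(i), the vertex \<xi>(j) stands at position n + i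
    - j, next to \<eta>(j-1).\<close>
  have "(\<xi> 0, \<eta> (j - 1)) \<in> E \<longleftrightarrow> (\<xi> j, \<eta> i) \<notin> E"
  proof -
    have "i < n" using ij by simp
    define \<xi>' where "\<xi>' l = \<xi> (if l \<le> i then l else n + i - l)" for l
    define \<eta>' where "\<eta>' l = \<eta> (if l < i then l else n - 1 + i - l)" for l
    have "ham_path n X Y E \<xi>' \<eta>'"
      using ham_path_rotate_end[OF p \<open>i < n\<close> ij(3)] unfolding \<xi>'_def[abs_def] \<eta>'_def[abs_def] .
    note c = crossing[OF this, of "n + i - j"]
    have l: "n + i - j < n" "\<not> n + i - j \<le> i" "\<not> n + i - j < i" "n + i - (n + i - j) = j"
      "n - 1 + i - (n + i - j) = j - 1" "\<not> n - 1 < i" "n - 1 + i - (n - 1) = i" using ij by auto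
    have "\<xi>' 0 = \<xi> 0" "\<xi>' (n + i - j) = \<xi> j" "\<eta>' (n - 1) = \<eta> i" "\<eta>' (n + i - j) = \<eta> (j - 1)"
      unfolding \<xi>'_def \<eta>'_def by (simp_all only: l if_False if_True le0)
    with c l(1) show ?thesis by simp
  qed
  moreover have "(\<xi> 0, \<eta> (j - 1)) \<in> E \<longleftrightarrow> (\<xi> (j - 1), \<eta> (n - 1)) \<notin> E"
    using crossing[OF p] ij by simp
  \<comment> \<open>With the start rotated to \<xi>(j), position j - 1 - i carries \<xi>(i+1) and
    \<eta>(i).\<close>
  moreover have "(\<xi> j, \<eta> i) \<in> E \<longleftrightarrow> (\<xi> (Suc i), \<eta> (n - 1)) \<notin> E"
  proof -
    have "(\<xi> 0, \<eta> j) \<in> E" using crossing[OF p] ij by simp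
    define \<xi>' where "\<xi>' l = \<xi> (if l \<le> j then j - l else l)" for l
    define \<eta>' where "\<eta>' l = \<eta> (if l < j then j - 1 - l else l)" for l
    have "ham_path n X Y E \<xi>' \<eta>'"
      using ham_path_rotate_start[OF p ij(2) \<open>(\<xi> 0, \<eta> j) \<in> E\<close>]
      unfolding \<xi>'_def[abs_def] \<eta>'_def[abs_def] .
    note c = crossing[OF this, of "j - 1 - i"]
    have l: "j - 1 - i < n" "j - 1 - i \<le> j" "j - 1 - i < j" "j - (j - 1 - i) = Suc i"
      "j - 1 - (j - 1 - i) = i" "\<not> n - 1 < j" using ij by auto
    have "\<xi>' 0 = \<xi> j" "\<xi>' (j - 1 - i) = \<xi> (Suc i)" "\<eta>' (n - 1) = \<eta> (n - 1)" "\<eta>' (j - 1 - i) = \<eta> i"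
      unfolding \<xi>'_def \<eta>'_def by (simp_all only: l if_False if_True le0 diff_zero)
    with c l(1) show ?thesis by simp
  qed
  ultimately show ?thesis by blast
qed

text \<open>Let l be the first index after i with \<xi>(l) not adjacent to the end. Then \<xi>(l-1)
  is adjacent to it, so the exchange for i and l rules out \<xi>(i+1). Feeding this into the
  exchange for i and j yields the claim on \<xi>(j-1).\<close>

lemma crossing_no_consecutive:
  assumes nh: "\<not> hamiltonian n X Y E" and p: "ham_path n X Y E \<xi> \<eta>"
    and deg: "\<forall>x\<in>X. \<forall>y\<in>Y. (x, y) \<notin> E \<longrightarrow>
      card {y \<in> Y. (x, y) \<in> E} + card {x \<in> X. (x, y) \<in> E} = n"
    and ij: "i < j" "j < n" "(\<xi> i, \<eta> (n - 1)) \<in> E" "(\<xi> j, \<eta> (n - 1)) \<notin> E"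
  shows "(\<xi> (Suc i), \<eta> (n - 1)) \<notin> E" "(\<xi> (j - 1), \<eta> (n - 1)) \<in> E"
proof -
  let ?P = "\<lambda>l. i < l \<and> l < n \<and> (\<xi> l, \<eta> (n - 1)) \<notin> E"
  have "?P j" using ij by simp
  then obtain l where P: "?P l" and least: "\<forall>l'<l. \<not> ?P l'"
    using exists_least_iff[of ?P] by blast
  have "(\<xi> (l - 1), \<eta> (n - 1)) \<in> E"
  proof (cases "l - 1 = i")
    case False
    have "l - 1 < l" using P by linarith
    then have "\<not> ?P (l - 1)" using least by blast
    moreover have "i < l - 1" "l - 1 < n" using P False by auto
    ultimately show ?thesis by blast
  qed (use ij in auto)
  then show 1: "(\<xi> (Suc i), \<eta> (n - 1)) \<notin> E"
    using crossing_exchange[OF nh p deg, of i l] P ij by blast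
  show "(\<xi> (j - 1), \<eta> (n - 1)) \<in> E"
    using crossing_exchange[OF nh p deg ij] 1 by blast
qed

text \<open>The previous lemma alone would admit alternating patterns. The inequality n \<ge> 2k + 1
  excludes them: it forces two consecutive nonneighbours of the end in front of its first
  neighbour.\<close>

lemma crossing_final_segment:
  assumes nh: "\<not> hamiltonian n X Y E" and p: "ham_path n X Y E \<xi> \<eta>"
    and deg: "\<forall>x\<in>X. \<forall>y\<in>Y. (x, y) \<notin> E \<longrightarrow>
      card {y \<in> Y. (x, y) \<in> E} + card {x \<in> X. (x, y) \<in> E} = n"
    and k: "card {x \<in> X. (x, \<eta> (n - 1)) \<in> E} = k" "2 * k + 1 \<le> n"
    and ij: "i < n" "j < n" "(\<xi> i, \<eta> (n - 1)) \<in> E" "(\<xi> j, \<eta> (n - 1)) \<notin> E"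
  shows "j < i"
proof (rule ccontr)
  assume "\<not> j < i"
  with ij have "i < j" by (metis linorder_neqE_nat)
  let ?in = "\<lambda>l. (\<xi> l, \<eta> (n - 1)) \<in> E"
  note nc = crossing_no_consecutive[OF nh p deg]
  define m where "m = (LEAST l. ?in l)"
  have m: "?in m" "m \<le> i" unfolding m_def using ij by (auto intro: LeastI Least_le)
  have below: "\<not> ?in l" if "l < m" for l using not_less_Least that unfolding m_def by blast
  have mj: "m < j" using m \<open>i < j\<close> by simp
  have m1: "\<not> ?in (Suc m)" using nc(1)[OF mj] m ij by simp
  \<comment> \<open>Beyond $m$ every nonneighbour of $\eta(n-1)$ directly follows a neighbour, so there are fewer
    than $k$ of them; as $n \ge 2k + 1$, at least two nonneighbours precede $m$, and rotating the
    start to $\xi(m+1)$ puts them behind a neighbour.\<close>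
  have "2 \<le> m"
  proof -
    let ?I = "{l. l < n \<and> ?in l}" and ?N = "{l. l < n \<and> \<not> ?in l}"
    let ?A = "{l. m < l \<and> l < n \<and> \<not> ?in l}"
    have cI: "card ?I = k" using k ham_path_card_left[OF p, of "\<lambda>x. (x, \<eta> (n - 1)) \<in> E"] by simp
    have "?I \<union> ?N = {..<n}" "?I \<inter> ?N = {}" by auto
    then have "n = k + card ?N" using card_Un_disjoint[of ?I ?N] cI by auto
    moreover have "?N \<subseteq> {..<m} \<union> ?A" using m(1) by (auto simp: not_less) (metis order_le_imp_less_or_eq)
    then have "card ?N \<le> card ({..<m} \<union> ?A)" by (intro card_mono) auto
    then have "card ?N \<le> m + card ?A" using card_Un_le[of "{..<m}" ?A] by simp
    moreover have "card ?A < k"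
    proof -
      \<comment> \<open>The index n - 1 belongs to a neighbour but is not the predecessor of any
        index below n; this makes the comparison of cardinalities strict.\<close>
      have last: "?in (n - 1)" using p ij by (auto simp: ham_path_def)
      have "inj_on (\<lambda>l. l - 1) ?A" by (auto simp: inj_on_def)
      then have "card ?A = card ((\<lambda>l. l - 1) ` ?A)" by (simp add: card_image)
      also have "\<dots> < card ?I"
      proof (rule psubset_card_mono)
        have "n - 1 \<notin> (\<lambda>l. l - 1) ` ?A" by auto
        moreover have "(\<lambda>l. l - 1) ` ?A \<subseteq> ?I" using nc(2)[of m] m by auto
        ultimately show "(\<lambda>l. l - 1) ` ?A \<subset> ?I" using last ij by auto
      qed auto
      finally show ?thesis using cI by simp
    qed
    ultimately show ?thesis using k by linarith
  qed
  have Sm: "Suc m < n" using mj ij by simp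
  have start: "(\<xi> 0, \<eta> (Suc m)) \<in> E"
  proof -
    have "(\<xi> 0, \<eta> (n - 1)) \<notin> E" using nh p by (auto simp: hamiltonian_def)
    then have "card {y \<in> Y. (\<xi> 0, y) \<in> E} + card {x \<in> X. (x, \<eta> (n - 1)) \<in> E} = n"
      using ham_path_in_range[OF p] ij deg by simp
    from nonhamiltonian_crossing_iff[OF nh p this Sm] m1 show ?thesis by simp
  qed
  define \<xi>' where "\<xi>' j = \<xi> (if j \<le> Suc m then Suc m - j else j)" for j
  define \<eta>' where "\<eta>' j = \<eta> (if j < Suc m then Suc m - 1 - j else j)" for j
  have q: "ham_path n X Y E \<xi>' \<eta>'"
    using ham_path_rotate_start[OF p Sm start] unfolding \<xi>'_def[abs_def] \<eta>'_def[abs_def] .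
  have "\<not> n - 1 < Suc m" using Sm \<open>2 \<le> m\<close> ij mj by auto
  then have idx: "\<eta>' (n - 1) = \<eta> (n - 1)" "\<xi>' 1 = \<xi> m" "\<xi>' 3 = \<xi> (m - 2)"
    using Sm \<open>2 \<le> m\<close> by (simp_all add: \<xi>'_def \<eta>'_def Suc_diff_le eval_nat_numeral)
  have idx2: "\<xi>' (3 - 1) = \<xi> (m - 1)"
    using Sm \<open>2 \<le> m\<close> by (simp add: \<xi>'_def)
  \<comment> \<open>In the rotated order position 1 is a neighbour of the end, while positions 2 and
    3 are the nonneighbours \<xi>(m-1) and \<xi>(m-2). Yet a nonneighbour behind a neighbour must
    directly follow a neighbour.\<close>
  have "(\<xi>' (3 - 1), \<eta>' (n - 1)) \<in> E"
  proof (rule crossing_no_consecutive(2)[OF nh q deg])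
    show "1 < (3::nat)" "3 < n" using Sm \<open>2 \<le> m\<close> by auto
    show "(\<xi>' 1, \<eta>' (n - 1)) \<in> E" "(\<xi>' 3, \<eta>' (n - 1)) \<notin> E"
      unfolding idx using m \<open>2 \<le> m\<close> below[of "m - 2"] by auto
  qed
  then show False
    unfolding idx(1) idx2 using \<open>2 \<le> m\<close> below[of "m - 1"] by auto
qed

text \<open>T consists of the nonneighbours \<xi>(j) of the last vertex, S of the \<eta>(i) whose
  index belongs to a neighbour. Since j < i, an edge from \<xi>(j) to \<eta>(i) would forbid the
  edge from \<xi>(0) to \<eta>(j), which the exact dichotomy provides.\<close>

lemma nonhamiltonian_block:
  assumes nh: "\<not> hamiltonian n X Y E" and p: "ham_path n X Y E \<xi> \<eta>"
    and deg: "\<forall>x\<in>X. \<forall>y\<in>Y. (x, y) \<notin> E \<longrightarrow>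
      card {y \<in> Y. (x, y) \<in> E} + card {x \<in> X. (x, y) \<in> E} = n"
    and k: "card {x \<in> X. (x, \<eta> (n - 1)) \<in> E} = k" "2 * k + 1 \<le> n"
  obtains T S where "T \<subseteq> X" "S \<subseteq> Y" "card T = n - k" "card S = k" "T \<times> S \<inter> E = {}"
proof -
  let ?I = "{l. l < n \<and> (\<xi> l, \<eta> (n - 1)) \<in> E}"
  have cI: "card ?I = k" using k ham_path_card_left[OF p, of "\<lambda>x. (x, \<eta> (n - 1)) \<in> E"] by simp
  have b: "inj_on \<xi> {..<n}" "inj_on \<eta> {..<n}" using p by (auto simp: ham_path_def bij_betw_def)
  have sub: "?I \<subseteq> {..<n}" by auto
  show ?thesis
  proof (rule that[of "\<xi> ` ({..<n} - ?I)" "\<eta> ` ?I"])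
    show "\<xi> ` ({..<n} - ?I) \<subseteq> X" "\<eta> ` ?I \<subseteq> Y" using ham_path_in_range[OF p] by auto
    have "inj_on \<xi> ({..<n} - ?I)" "inj_on \<eta> ?I" using b by (auto simp: inj_on_def)
    then show "card (\<xi> ` ({..<n} - ?I)) = n - k" "card (\<eta> ` ?I) = k"
      using sub cI by (simp_all add: card_image card_Diff_subset)
    have "(\<xi> j, \<eta> i) \<notin> E" if i: "i < n" "(\<xi> i, \<eta> (n - 1)) \<in> E" and j: "j < n" "(\<xi> j, \<eta> (n - 1)) \<notin> E"
      for i j
    proof -
      have "j < i" by (rule crossing_final_segment[OF nh p deg k]) (use i j in auto)
      have e: "(\<xi> 0, \<eta> (n - 1)) \<notin> E" using nh p by (auto simp: hamiltonian_def)
      then have "card {y \<in> Y. (\<xi> 0, y) \<in> E} + card {x \<in> X. (x, \<eta> (n - 1)) \<in> E} = n"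
        using ham_path_in_range[OF p] i deg by simp
      from nonhamiltonian_crossing_iff[OF nh p this j(1)] j(2) have "(\<xi> 0, \<eta> j) \<in> E" by simp
      then show ?thesis using nonhamiltonian_crossing_rotated[OF nh p i \<open>j < i\<close>] by blast
    qed
    then show "\<xi> ` ({..<n} - ?I) \<times> \<eta> ` ?I \<inter> E = {}" by auto
  qed
qed

section \<open>Extremal nonhamiltonian balanced graphs\<close>

text \<open>The variational form of a bound on the largest singular value of the biadjacency matrix
  of \<open>D\<close>. It avoids matrices, is insensitive to swapping the sides, and can be tested
  on any pair of functions.\<close>

definition form_bounded :: "'a set \<Rightarrow> 'b set \<Rightarrow> ('a \<times> 'b) set \<Rightarrow> real \<Rightarrow> bool" where
  "form_bounded X Y D \<theta> \<longleftrightarrow> (\<forall>f g. 2 * (\<Sum>(x, y)\<in>D. f x * g y)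
     \<le> \<theta> * ((\<Sum>x\<in>X. (f x)\<^sup>2) + (\<Sum>y\<in>Y. (g y)\<^sup>2)))"

lemma form_boundedD:
  assumes "form_bounded X Y D \<theta>"
  shows "2 * (\<Sum>(x, y)\<in>D. f x * g y) \<le> \<theta> * ((\<Sum>x\<in>X. (f x)\<^sup>2) + (\<Sum>y\<in>Y. (g y)\<^sup>2))"
  using assms unfolding form_bounded_def by blast

lemma form_bounded_converse:
  assumes "form_bounded X Y D \<theta>"
  shows "form_bounded Y X (D\<inverse>) \<theta>"
  unfolding form_bounded_def
proof (intro allI)
  fix f :: "'b \<Rightarrow> real" and g :: "'a \<Rightarrow> real"
  have "D\<inverse> = prod.swap ` D" by auto
  then have "(\<Sum>(x, y)\<in>D\<inverse>. f x * g y) = (\<Sum>(x, y)\<in>D. g x * f y)"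
    by (simp add: sum.reindex case_prod_unfold mult.commute)
  then show "2 * (\<Sum>(x, y)\<in>D\<inverse>. f x * g y) \<le> \<theta> * ((\<Sum>x\<in>Y. (f x)\<^sup>2) + (\<Sum>y\<in>X. (g y)\<^sup>2))"
    using form_boundedD[OF assms, of g f] by (simp add: add.commute)
qed

section \<open>Test vectors for the spectral bound\<close>

lemma sum_degrees:
  assumes "finite X" "finite Y" "D \<subseteq> X \<times> Y"
  shows "(\<Sum>x\<in>X. card {y \<in> Y. (x, y) \<in> D}) = card D" "(\<Sum>y\<in>Y. card {x \<in> X. (x, y) \<in> D}) = card D"
proof -
  have "(SIGMA x:X. {y \<in> Y. (x, y) \<in> D}) = D" using assms(3) by auto
  then show "(\<Sum>x\<in>X. card {y \<in> Y. (x, y) \<in> D}) = card D"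
    using assms card_SigmaI[of X "\<lambda>x. {y \<in> Y. (x, y) \<in> D}"] by simp
  have "(SIGMA y:Y. {x \<in> X. (x, y) \<in> D}) = D\<inverse>" using assms(3) by auto
  then show "(\<Sum>y\<in>Y. card {x \<in> X. (x, y) \<in> D}) = card D"
    using assms card_SigmaI[of Y "\<lambda>y. {x \<in> X. (x, y) \<in> D}"] by simp
qed

text \<open>The squares of the square roots of the degrees sum to 2|D|, so the form bound says that
  the average over the pairs of D of sqrt(a b) is at most sqrt(c), while each term is at least
  sqrt(c). Hence all terms are equal. Evaluating the form on D' instead of D only adds nonnegative
  terms.\<close>

lemma degree_product_eq:
  assumes fin: "finite X" "finite Y" and D: "D \<subseteq> D'" "D' \<subseteq> X \<times> Y"
    and bound: "form_bounded X Y D' (sqrt (real c))"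
    and deg: "\<forall>(x, y)\<in>D. c \<le> card {y \<in> Y. (x, y) \<in> D} * card {x \<in> X. (x, y) \<in> D}"
    and xy: "(x, y) \<in> D"
  shows "card {y \<in> Y. (x, y) \<in> D} * card {x \<in> X. (x, y) \<in> D} = c"
proof -
  define a where "a x = card {y \<in> Y. (x, y) \<in> D}" for x
  define b where "b y = card {x \<in> X. (x, y) \<in> D}" for y
  have "finite D'" by (rule finite_subset[OF D(2)]) (simp add: fin)
  moreover from this have "finite D" by (rule finite_subset[OF D(1)])
  ultimately have finD: "finite D'" "finite D" .
  have sums: "(\<Sum>x\<in>X. a x) = card D" "(\<Sum>y\<in>Y. b y) = card D"
    using sum_degrees[OF fin, of D] D by (auto simp: a_def b_def)
  have le: "sqrt (real c) \<le> sqrt (a x) * sqrt (b y)" if "(x, y) \<in> D" for x y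
  proof -
    have "c \<le> a x * b y" using deg that by (auto simp: a_def b_def)
    then have "sqrt (real c) \<le> sqrt (real (a x * b y))" by (simp del: of_nat_mult)
    then show ?thesis by (simp add: real_sqrt_mult)
  qed
  have "2 * (\<Sum>(x, y)\<in>D. sqrt (a x) * sqrt (b y)) \<le> 2 * (\<Sum>(x, y)\<in>D'. sqrt (a x) * sqrt (b y))"
    using finD D by (intro mult_left_mono sum_mono2) auto
  also have "\<dots> \<le> sqrt c * ((\<Sum>x\<in>X. (sqrt (a x))\<^sup>2) + (\<Sum>y\<in>Y. (sqrt (b y))\<^sup>2))"
    by (rule form_boundedD[OF bound])
  also have "\<dots> = sqrt c * (real (\<Sum>x\<in>X. a x) + real (\<Sum>y\<in>Y. b y))" by simp
  also have "\<dots> = 2 * (\<Sum>(x, y)\<in>D. sqrt c)" unfolding sums by simp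
  finally have le0: "(\<Sum>p\<in>D. sqrt (a (fst p)) * sqrt (b (snd p)) - sqrt c) \<le> 0"
    by (simp add: sum_subtractf case_prod_unfold)
  have nonneg: "0 \<le> sqrt (a (fst p)) * sqrt (b (snd p)) - sqrt c" if "p \<in> D" for p
    using le[of "fst p" "snd p"] that by simp
  have "(\<Sum>p\<in>D. sqrt (a (fst p)) * sqrt (b (snd p)) - sqrt c) = 0"
    by (rule antisym[OF le0]) (rule sum_nonneg[OF nonneg])
  from sum_nonneg_0[OF finD(2) nonneg this xy]
  have "sqrt (a x) * sqrt (b y) = sqrt c" by simp
  then have "sqrt (real (a x * b y)) = sqrt (real c)" by (simp add: real_sqrt_mult)
  then have "a x * b y = c" by (simp del: of_nat_mult)
  then show ?thesis by (simp add: a_def b_def)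
qed

text \<open>The assumed bound is exactly the value attained by the block T x S. Putting a small
  weight on a further neighbour of T gains linearly and costs only quadratically, so such a
  neighbour would violate the bound.\<close>

lemma complete_block_isolated_right:
  assumes fin: "finite X" "finite Y" and D: "T \<times> S \<subseteq> D" "D \<subseteq> X \<times> Y" and TS: "T \<noteq> {}" "S \<noteq> {}"
    and bound: "form_bounded X Y D (sqrt (real (card T * card S)))"
    and xy: "(x, y) \<in> D" "x \<in> T"
  shows "y \<in> S"
proof (rule ccontr)
  assume y: "y \<notin> S"
  have sub: "T \<subseteq> X" "S \<subseteq> Y" using D TS by auto
  have fin': "finite T" "finite S" using sub fin finite_subset by auto
  define s t where "s = real (card S)" and "t = real (card T)"
  have pos: "0 < s" "0 < t" using TS fin' by (auto simp: s_def t_def card_gt_0_iff)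
  define \<theta> where "\<theta> = sqrt (t * s)"
  have \<theta>: "0 < \<theta>" using pos by (simp add: \<theta>_def)
  \<comment> \<open>This weight maximizes the net gain 2 sqrt(s) \<epsilon> - \<theta>
    \<epsilon>^2.\<close>
  define \<epsilon> where "\<epsilon> = sqrt s / \<theta>"
  have \<epsilon>: "0 < \<epsilon>" using pos \<theta> by (simp add: \<epsilon>_def)
  define f where "f x = (if x \<in> T then sqrt s else 0)" for x
  define g where "g v = (if v \<in> S then sqrt t else if v = y then \<epsilon> else 0)" for v
  have finD: "finite D" by (rule finite_subset[OF D(2)]) (simp add: fin)
  have "(\<Sum>(x, y)\<in>insert (x, y) (T \<times> S). f x * g y) \<le> (\<Sum>(x, y)\<in>D. f x * g y)"
    using finD D xy pos \<epsilon> by (intro sum_mono2) (auto simp: f_def g_def)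
  also have "(\<Sum>(x, y)\<in>insert (x, y) (T \<times> S). f x * g y) = sqrt s * \<epsilon> + (\<Sum>(x, y)\<in>T \<times> S. sqrt s * sqrt t)"
  proof -
    have "(\<Sum>(x, y)\<in>T \<times> S. f x * g y) = (\<Sum>(x, y)\<in>T \<times> S. sqrt s * sqrt t)"
      by (intro sum.cong) (auto simp: f_def g_def)
    then show ?thesis using fin' y xy by (simp add: f_def g_def)
  qed
  also have "(\<Sum>(x, y)\<in>T \<times> S. sqrt s * sqrt t) = t * s * \<theta>"
    by (simp add: card_cartesian_product s_def t_def \<theta>_def real_sqrt_mult case_prod_unfold)
  finally have "2 * (sqrt s * \<epsilon> + t * s * \<theta>) \<le> 2 * (\<Sum>(x, y)\<in>D. f x * g y)" by simp
  also have "\<dots> \<le> \<theta> * ((\<Sum>x\<in>X. (f x)\<^sup>2) + (\<Sum>y\<in>Y. (g y)\<^sup>2))"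
    using form_boundedD[OF bound] by (simp add: \<theta>_def s_def t_def)
  also have "(\<Sum>x\<in>X. (f x)\<^sup>2) = (\<Sum>x\<in>T. s)"
    using fin sub pos by (intro sum.mono_neutral_cong_right) (auto simp: f_def)
  also have "(\<Sum>y\<in>Y. (g y)\<^sup>2) = (\<Sum>v\<in>insert y S. (g v)\<^sup>2)"
    using fin sub pos D xy by (intro sum.mono_neutral_right) (auto simp: g_def)
  also have "\<dots> = \<epsilon>\<^sup>2 + (\<Sum>v\<in>S. t)"
  proof -
    have "(\<Sum>v\<in>S. (g v)\<^sup>2) = (\<Sum>v\<in>S. t)" using pos by (intro sum.cong) (auto simp: g_def)
    then show ?thesis using fin' y by (simp add: g_def)
  qed
  finally have "2 * sqrt s * \<epsilon> + 2 * t * s * \<theta> \<le> \<theta> * (2 * t * s + \<epsilon>\<^sup>2)"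
    by (simp add: s_def t_def algebra_simps)
  then have "2 * sqrt s * \<epsilon> \<le> (\<theta> * \<epsilon>) * \<epsilon>" by (simp add: algebra_simps power2_eq_square)
  also have "\<theta> * \<epsilon> = sqrt s" using \<theta> by (simp add: \<epsilon>_def)
  finally show False using \<epsilon> pos by simp
qed

lemma complete_block_isolated:
  assumes fin: "finite X" "finite Y" and D: "T \<times> S \<subseteq> D" "D \<subseteq> X \<times> Y" and TS: "T \<noteq> {}" "S \<noteq> {}"
    and bound: "form_bounded X Y D (sqrt (real (card T * card S)))"
    and xy: "(x, y) \<in> D"
  shows "x \<in> T \<longleftrightarrow> y \<in> S"
proof
  show "x \<in> T \<Longrightarrow> y \<in> S" using complete_block_isolated_right[OF fin D TS bound xy] .
  have "form_bounded Y X (D\<inverse>) (sqrt (real (card S * card T)))"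
    using form_bounded_converse[OF bound] by (simp add: mult.commute)
  then show "y \<in> S \<Longrightarrow> x \<in> T"
    using complete_block_isolated_right[OF fin(2,1) _ _ TS(2,1), of "D\<inverse>" y x] D xy by auto
qed

lemma exists_nonadjacent_if_nonhamiltonian:
  assumes "finite X" "finite Y" "card X = n" "card Y = n" "0 < n" "\<not> hamiltonian n X Y E"
  obtains x y where "x \<in> X" "y \<in> Y" "(x, y) \<notin> E"
proof -
  obtain \<xi> where \<xi>: "bij_betw \<xi> {..<n} X"
    using ex_bij_betw_nat_finite[OF assms(1)] assms(3) by (auto simp: atLeast0LessThan)
  obtain \<eta> where \<eta>: "bij_betw \<eta> {..<n} Y"
    using ex_bij_betw_nat_finite[OF assms(2)] assms(4) by (auto simp: atLeast0LessThan)
  have range: "\<xi> i \<in> X" "\<eta> i \<in> Y" if "i < n" for i using \<xi> \<eta> that by (auto simp: bij_betw_def)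
  show ?thesis
  proof (rule ccontr)
    assume "\<not> thesis"
    then have all: "\<forall>x\<in>X. \<forall>y\<in>Y. (x, y) \<in> E" using that by blast
    have "ham_path n X Y E \<xi> \<eta>" unfolding ham_path_def using \<xi> \<eta> range all by simp
    moreover have "(\<xi> 0, \<eta> (n - 1)) \<in> E" using range all assms(5) by simp
    ultimately show False using assms(6) by (blast dest: hamiltonianI)
  qed
qed

lemma card_nonneighbours:
  assumes "finite Z" "card Z = n"
  shows "card {z \<in> Z. P z} + card {z \<in> Z. \<not> P z} = n"
proof -
  have "card ({z \<in> Z. P z} \<union> {z \<in> Z. \<not> P z}) = card {z \<in> Z. P z} + card {z \<in> Z. \<not> P z}"
    using assms by (intro card_Un_disjoint) auto
  moreover have "{z \<in> Z. P z} \<union> {z \<in> Z. \<not> P z} = Z" by auto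
  ultimately show ?thesis using assms by simp
qed

text \<open>The spectral hypothesis speaks about nonadjacent pairs, so maximality is restated for
  them: a degree sum of at most n in the graph becomes one of at least 2n - n in the
  complement.\<close>

lemma maximal_nonhamiltonian_complement:
  assumes fin: "finite X" "finite Y" and card: "card X = n" "card Y = n" and n: "2 \<le> n"
    and E: "E \<subseteq> X \<times> Y" "\<not> hamiltonian n X Y E"
  obtains D where "D \<subseteq> X \<times> Y - E" "D \<noteq> {}" "\<not> hamiltonian n X Y (X \<times> Y - D)"
    "\<forall>(x, y)\<in>D. \<exists>\<xi> \<eta>. ham_path n X Y (X \<times> Y - D) \<xi> \<eta> \<and> \<xi> 0 = x \<and> \<eta> (n - 1) = y"
    "\<forall>(x, y)\<in>D. n \<le> card {y \<in> Y. (x, y) \<in> D} + card {x \<in> X. (x, y) \<in> D}"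
proof -
  obtain M where M: "E \<subseteq> M" "M \<subseteq> X \<times> Y" "\<not> hamiltonian n X Y M"
    and path: "\<And>x y. x \<in> X \<Longrightarrow> y \<in> Y \<Longrightarrow> (x, y) \<notin> M \<Longrightarrow>
       \<exists>\<xi> \<eta>. ham_path n X Y M \<xi> \<eta> \<and> \<xi> 0 = x \<and> \<eta> (n - 1) = y"
    using maximal_nonhamiltonian[OF fin n E] by metis
  define D where "D = X \<times> Y - M"
  have MD: "M = X \<times> Y - D" using M(2) by (auto simp: D_def)
  show ?thesis
  proof (rule that[of D])
    show "D \<subseteq> X \<times> Y - E" using M(1) by (auto simp: D_def)
    show "D \<noteq> {}"
      by (rule exists_nonadjacent_if_nonhamiltonian[OF fin card _ M(3)]) (use n in \<open>auto simp: D_def\<close>)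
    show "\<not> hamiltonian n X Y (X \<times> Y - D)" using M(3) MD by simp
    show "\<forall>(x, y)\<in>D. \<exists>\<xi> \<eta>. ham_path n X Y (X \<times> Y - D) \<xi> \<eta> \<and> \<xi> 0 = x \<and> \<eta> (n - 1) = y"
      using path unfolding MD[symmetric] by (auto simp: D_def)
    show "\<forall>(x, y)\<in>D. n \<le> card {y \<in> Y. (x, y) \<in> D} + card {x \<in> X. (x, y) \<in> D}"
    proof clarify
      fix x y assume xy: "(x, y) \<in> D"
      then have "x \<in> X" "y \<in> Y" "(x, y) \<notin> M" by (auto simp: D_def)
      from path[OF this] obtain \<xi> \<eta> where "ham_path n X Y M \<xi> \<eta>" "\<xi> 0 = x" "\<eta> (n - 1) = y" by blast
      with nonhamiltonian_degree_sum[OF M(3)]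
      have "card {y \<in> Y. (x, y) \<in> M} + card {x \<in> X. (x, y) \<in> M} \<le> n" by blast
      moreover have eq: "{y \<in> Y. (x, y) \<in> D} = {y \<in> Y. (x, y) \<notin> M}" "{x \<in> X. (x, y) \<in> D} = {x \<in> X. (x, y) \<notin> M}"
        using \<open>x \<in> X\<close> \<open>y \<in> Y\<close> by (auto simp: D_def)
      ultimately show "n \<le> card {y \<in> Y. (x, y) \<in> D} + card {x \<in> X. (x, y) \<in> D}"
        unfolding eq
        using card_nonneighbours[OF fin(2) card(2), of "\<lambda>y. (x, y) \<in> M"]
          card_nonneighbours[OF fin(1) card(1), of "\<lambda>x. (x, y) \<in> M"] by linarith
    qed
  qed
qed

text \<open>Everything follows from a(n - a) = k(n - k) + (a - k)(n - k - a), whose last product is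
  nonnegative for a between k and n - k and vanishes only at the two ends.\<close>

lemma product_lower_bound:
  fixes a b k n :: nat
  assumes "n \<le> a + b" "k \<le> a" "a + k \<le> n" 
  shows "k * (n - k) \<le> a * (n - a)" "a * (n - a) \<le> a * b"
    "a * b = k * (n - k) \<Longrightarrow> 0 < a \<Longrightarrow> (a = k \<or> a + k = n) \<and> a + b = n"
proof -
  have id: "a * (n - a) = k * (n - k) + (a - k) * (n - k - a)"
  proof -
    obtain d where d: "a = k + d" using assms by (metis le_Suc_ex)
    obtain e where e: "n = a + k + e" using assms by (metis le_Suc_ex)
    show ?thesis unfolding e d by (simp add: algebra_simps)
  qed
  then show "k * (n - k) \<le> a * (n - a)" by simp
  show le: "a * (n - a) \<le> a * b" using assms by (intro mult_left_mono) auto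
  show "(a = k \<or> a + k = n) \<and> a + b = n" if "a * b = k * (n - k)" "0 < a"
  proof -
    have eq: "a * (n - a) = a * b" "(a - k) * (n - k - a) = 0" using that(1) le id by auto
    then have "b = n - a" using that(2) by simp
    with eq(2) assms show ?thesis by auto
  qed
qed

lemma nonhamiltonian_extremal:
  assumes fin: "finite X" "finite Y" and card: "card X = n" "card Y = n" and k: "1 \<le> k" "2 * k + 1 \<le> n"
    and E: "E \<subseteq> X \<times> Y" "\<not> hamiltonian n X Y E"
    and deg: "\<forall>x\<in>X. k + 1 \<le> card {y \<in> Y. (x, y) \<in> E}" "\<forall>y\<in>Y. k \<le> card {x \<in> X. (x, y) \<in> E}"
    and bound: "form_bounded X Y (X \<times> Y - E) (sqrt (real (k * (n - k))))"
  obtains T S where "T \<subseteq> X" "S \<subseteq> Y" "card T = n - k" "card S = k"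
    "\<forall>x\<in>X. \<forall>y\<in>Y. (x \<in> T \<and> y \<in> S \<longrightarrow> (x, y) \<notin> E) \<and> ((x \<in> T) \<noteq> (y \<in> S) \<longrightarrow> (x, y) \<in> E)"
proof -
  have n: "2 \<le> n" using k by simp
  obtain D where D: "D \<subseteq> X \<times> Y - E" "D \<noteq> {}" and nh: "\<not> hamiltonian n X Y (X \<times> Y - D)"
    and path: "\<forall>(x, y)\<in>D. \<exists>\<xi> \<eta>. ham_path n X Y (X \<times> Y - D) \<xi> \<eta> \<and> \<xi> 0 = x \<and> \<eta> (n - 1) = y"
    and sum: "\<forall>(x, y)\<in>D. n \<le> card {y \<in> Y. (x, y) \<in> D} + card {x \<in> X. (x, y) \<in> D}"
    by (rule maximal_nonhamiltonian_complement[OF fin card n E])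
  define a where "a x = card {y \<in> Y. (x, y) \<in> D}" for x
  define b where "b y = card {x \<in> X. (x, y) \<in> D}" for y
  have a: "a x + k + 1 \<le> n" if "x \<in> X" for x
  proof -
    have "a x \<le> card {y \<in> Y. (x, y) \<notin> E}" unfolding a_def using D fin by (intro card_mono) auto
    then show ?thesis using card_nonneighbours[OF fin(2) card(2), of "\<lambda>y. (x, y) \<in> E"] deg(1) that by fastforce
  qed
  have b: "b y + k \<le> n" if "y \<in> Y" for y
  proof -
    have "b y \<le> card {x \<in> X. (x, y) \<notin> E}" unfolding b_def using D fin by (intro card_mono) auto
    then show ?thesis using card_nonneighbours[OF fin(1) card(1), of "\<lambda>x. (x, y) \<in> E"] deg(2) that by fastforce
  qed
  have pre: "n \<le> a x + b y" "k \<le> a x" "a x + k \<le> n" "a x + k + 1 \<le> n" if "(x, y) \<in> D" for x y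
  proof -
    have xy: "x \<in> X" "y \<in> Y" using that D by auto
    show s: "n \<le> a x + b y" using sum that by (auto simp: a_def b_def)
    show "k \<le> a x" using s b[OF xy(2)] by linarith
    show "a x + k \<le> n" "a x + k + 1 \<le> n" using a[OF xy(1)] by linarith+
  qed
  have "\<forall>(x, y)\<in>D. k * (n - k) \<le> card {y \<in> Y. (x, y) \<in> D} * card {x \<in> X. (x, y) \<in> D}"
  proof clarify
    fix x y assume xy: "(x, y) \<in> D"
    from product_lower_bound(1,2)[OF pre(1-3)[OF xy]]
    show "k * (n - k) \<le> card {y \<in> Y. (x, y) \<in> D} * card {x \<in> X. (x, y) \<in> D}"
      unfolding a_def b_def by (rule le_trans)
  qed
  from degree_product_eq[OF fin D(1) _ bound this]
  have prod: "a x * b y = k * (n - k)" if "(x, y) \<in> D" for x y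
    using that unfolding a_def b_def by auto
  \<comment> \<open>The other solution a x = n - k is excluded by the extra unit in the degree bound
    on X.\<close>
  have ab: "a x = k" "b y = n - k" if "(x, y) \<in> D" for x y
    using product_lower_bound(3)[OF pre(1-3)[OF that] prod[OF that]] pre[OF that] k by auto
  have M: "card {y \<in> Y. (x, y) \<in> X \<times> Y - D} = n - k" "card {x \<in> X. (x, y) \<in> X \<times> Y - D} = k"
    if "(x, y) \<in> D" for x y
  proof -
    have "{y \<in> Y. (x, y) \<in> X \<times> Y - D} = {y \<in> Y. (x, y) \<notin> D}"
      "{x \<in> X. (x, y) \<in> X \<times> Y - D} = {x \<in> X. (x, y) \<notin> D}" using that D by auto
    then show "card {y \<in> Y. (x, y) \<in> X \<times> Y - D} = n - k" "card {x \<in> X. (x, y) \<in> X \<times> Y - D} = k"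
      using card_nonneighbours[OF fin(2) card(2), of "\<lambda>y. (x, y) \<in> D"]
        card_nonneighbours[OF fin(1) card(1), of "\<lambda>x. (x, y) \<in> D"] ab[OF that] k
      unfolding a_def b_def by auto
  qed
  obtain x y where xy: "(x, y) \<in> D" using D(2) by auto
  from bspec[OF path this] obtain \<xi> \<eta>
    where p: "ham_path n X Y (X \<times> Y - D) \<xi> \<eta>" "\<xi> 0 = x" "\<eta> (n - 1) = y"
    by auto
  have degsum: "\<forall>x\<in>X. \<forall>y\<in>Y. (x, y) \<notin> X \<times> Y - D \<longrightarrow>
      card {y \<in> Y. (x, y) \<in> X \<times> Y - D} + card {x \<in> X. (x, y) \<in> X \<times> Y - D} = n"
  proof (intro ballI impI)
    fix x y assume "x \<in> X" "y \<in> Y" "(x, y) \<notin> X \<times> Y - D"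
    then have "(x, y) \<in> D" by auto
    from M[OF this] show "card {y \<in> Y. (x, y) \<in> X \<times> Y - D} + card {x \<in> X. (x, y) \<in> X \<times> Y - D} = n"
      using k by linarith
  qed
  have "card {x \<in> X. (x, \<eta> (n - 1)) \<in> X \<times> Y - D} = k" using M(2)[OF xy] p(3) by simp
  from nonhamiltonian_block[OF nh p(1) degsum this k(2)]
  obtain T S where TS: "T \<subseteq> X" "S \<subseteq> Y" "card T = n - k" "card S = k" "T \<times> S \<inter> (X \<times> Y - D) = {}" .
  \<comment> \<open>The block is found in D but isolated in the whole complement of E, where the
    form bound is available; so the structure is obtained for E itself and not only for its maximal
    extension.\<close>
  have block: "T \<times> S \<subseteq> X \<times> Y - E" using TS D by blast
  have "T \<noteq> {}" "S \<noteq> {}" using TS k by auto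
  moreover have "form_bounded X Y (X \<times> Y - E) (sqrt (real (card T * card S)))"
    using bound TS by (simp add: mult.commute)
  ultimately have iff: "x \<in> T \<longleftrightarrow> y \<in> S" if "(x, y) \<in> X \<times> Y - E" for x y
    using complete_block_isolated[OF fin block Diff_subset _ _ _ that] by simp
  have "\<forall>x\<in>X. \<forall>y\<in>Y. (x \<in> T \<and> y \<in> S \<longrightarrow> (x, y) \<notin> E) \<and> ((x \<in> T) \<noteq> (y \<in> S) \<longrightarrow> (x, y) \<in> E)"
  proof (intro ballI conjI impI)
    fix x y assume xy: "x \<in> X" "y \<in> Y"
    show "(x, y) \<notin> E" if "x \<in> T \<and> y \<in> S" using that block by blast
    show "(x, y) \<in> E" if "(x \<in> T) \<noteq> (y \<in> S)" using iff[of x y] that xy by auto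
  qed
  then show ?thesis by (rule that[OF TS(1,2) TS(3,4)])
qed

text \<open>The product bound is used with parameter 1: a x \<ge> 1 because the pair in question
  itself counts, and a x \<le> n - 1 by the degree condition. No crossing pattern is required, since
  a star around one end of a single pair of D is already a complete block of the critical
  size.\<close>

lemma nonhamiltonian_extremal_degree_zero:
  assumes fin: "finite X" "finite Y" and card: "card X = n" "card Y = n" and n: "2 \<le> n"
    and E: "E \<subseteq> X \<times> Y" "\<not> hamiltonian n X Y E"
    and deg: "\<forall>x\<in>X. 1 \<le> card {y \<in> Y. (x, y) \<in> E}"
    and bound: "form_bounded X Y (X \<times> Y - E) (sqrt (real (n - 1)))"
  obtains T S where "T \<subseteq> X" "S \<subseteq> Y" "card T = n - 1 \<and> card S = 1 \<or> card T = 1 \<and> card S = n - 1"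
    "\<forall>x\<in>X. \<forall>y\<in>Y. (x \<in> T \<and> y \<in> S \<longrightarrow> (x, y) \<notin> E) \<and> ((x \<in> T) \<noteq> (y \<in> S) \<longrightarrow> (x, y) \<in> E)"
proof -
  obtain D where D: "D \<subseteq> X \<times> Y - E" "D \<noteq> {}"
    and sum: "\<forall>(x, y)\<in>D. n \<le> card {y \<in> Y. (x, y) \<in> D} + card {x \<in> X. (x, y) \<in> D}"
    by (rule maximal_nonhamiltonian_complement[OF fin card n E])
  define a where "a x = card {y \<in> Y. (x, y) \<in> D}" for x
  define b where "b y = card {x \<in> X. (x, y) \<in> D}" for y
  have pre: "n \<le> a x + b y" "1 \<le> a x" "a x + 1 \<le> n" if "(x, y) \<in> D" for x y
  proof -
    have xy: "x \<in> X" "y \<in> Y" using that D by auto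
    show "n \<le> a x + b y" using sum that by (auto simp: a_def b_def)
    show "1 \<le> a x" using that xy fin by (auto simp: a_def Suc_le_eq card_gt_0_iff)
    have "a x \<le> card {y \<in> Y. (x, y) \<notin> E}" unfolding a_def using D fin by (intro card_mono) auto
    then show "a x + 1 \<le> n"
      using card_nonneighbours[OF fin(2) card(2), of "\<lambda>y. (x, y) \<in> E"] deg xy by fastforce
  qed
  have c: "1 * (n - 1) = n - 1" by simp
  have "\<forall>(x, y)\<in>D. n - 1 \<le> card {y \<in> Y. (x, y) \<in> D} * card {x \<in> X. (x, y) \<in> D}"
  proof clarify
    fix x y assume xy: "(x, y) \<in> D"
    from product_lower_bound(1,2)[OF pre(1-3)[OF xy]]
    show "n - 1 \<le> card {y \<in> Y. (x, y) \<in> D} * card {x \<in> X. (x, y) \<in> D}"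
      unfolding a_def b_def c by (rule le_trans)
  qed
  from degree_product_eq[OF fin D(1) _ bound this]
  have prod: "a x * b y = 1 * (n - 1)" if "(x, y) \<in> D" for x y
    using that unfolding a_def b_def by auto
  have ab: "a x = 1 \<and> b y = n - 1 \<or> a x = n - 1 \<and> b y = 1" if "(x, y) \<in> D" for x y
    using product_lower_bound(3)[OF pre(1-3)[OF that] prod[OF that]] pre[OF that] n by auto
  obtain x y where xy: "(x, y) \<in> D" using D(2) by auto
  \<comment> \<open>The star is centred at y if y has the large degree and at x otherwise.\<close>
  have "\<exists>T S. T \<subseteq> X \<and> S \<subseteq> Y \<and> T \<times> S \<subseteq> X \<times> Y - E \<and> (card T = n - 1 \<and> card S = 1 \<or> card T = 1 \<and> card S = n - 1)"
    using ab[OF xy]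
  proof
    assume "a x = 1 \<and> b y = n - 1"
    then show ?thesis using xy D
      by (intro exI[of _ "{x \<in> X. (x, y) \<in> D}"] exI[of _ "{y}"]) (auto simp: b_def)
  next
    assume "a x = n - 1 \<and> b y = 1"
    then show ?thesis using xy D
      by (intro exI[of _ "{x}"] exI[of _ "{y \<in> Y. (x, y) \<in> D}"]) (auto simp: a_def)
  qed
  then obtain T S where TS: "T \<subseteq> X" "S \<subseteq> Y" "T \<times> S \<subseteq> X \<times> Y - E"
    "card T = n - 1 \<and> card S = 1 \<or> card T = 1 \<and> card S = n - 1" by blast
  have "T \<noteq> {}" "S \<noteq> {}" using TS(4) n by auto
  moreover have "form_bounded X Y (X \<times> Y - E) (sqrt (real (card T * card S)))"
    using bound TS(4) by auto
  ultimately have iff: "x \<in> T \<longleftrightarrow> y \<in> S" if "(x, y) \<in> X \<times> Y - E" for x y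
    using complete_block_isolated[OF fin TS(3) Diff_subset _ _ _ that] by simp
  have "\<forall>x\<in>X. \<forall>y\<in>Y. (x \<in> T \<and> y \<in> S \<longrightarrow> (x, y) \<notin> E) \<and> ((x \<in> T) \<noteq> (y \<in> S) \<longrightarrow> (x, y) \<in> E)"
  proof (intro ballI conjI impI)
    fix x y assume xy: "x \<in> X" "y \<in> Y"
    show "(x, y) \<notin> E" if "x \<in> T \<and> y \<in> S" using that TS(3) by blast
    show "(x, y) \<in> E" if "(x \<in> T) \<noteq> (y \<in> S)" using iff[of x y] that xy by auto
  qed
  then show ?thesis by (rule that[OF TS(1,2) TS(4)])
qed

section \<open>Rayleigh quotients and the spectral radius of a graph\<close>

lemma linear_coeff_zero_if_quadratic_nonneg:
  fixes b c :: real
  assumes "\<And>t. 0 \<le> 2 * t * b + t\<^sup>2 * c"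
  shows "b = 0"
proof (rule ccontr)
  assume "b \<noteq> 0"
  define C where "C = \<bar>c\<bar> + 1"
  have C: "0 < C" "c < C" unfolding C_def by linarith+
  have "2 * (- b / C) * b + (- b / C)\<^sup>2 * c = (b\<^sup>2 / C) * (c / C - 2)"
    using C by (simp add: field_simps power2_eq_square)
  also have "\<dots> < 0"
  proof (rule mult_pos_neg)
    show "0 < b\<^sup>2 / C" using C \<open>b \<noteq> 0\<close> by simp
    have "c / C < 1" using C by simp
    then show "c / C - 2 < 0" by linarith
  qed
  finally show False using assms[of "- b / C"] by linarith
qed

text \<open>Functions vanishing outside V model the space of vectors indexed by V. The sphere is a
  closed subset of a product of compact intervals, compact by Tychonoff.\<close>

lemma compact_unit_sphere_fun:
  fixes V :: "'i set"
  assumes "finite V"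
  shows "compact {g :: 'i \<Rightarrow> real. (\<forall>i. i \<notin> V \<longrightarrow> g i = 0) \<and> (\<Sum>i\<in>V. (g i)\<^sup>2) = 1}" (is "compact ?K")
proof -
  let ?P = "PiE UNIV (\<lambda>i. if i \<in> V then {-1..1} else {0 :: real})"
  have "compactin (product_topology (\<lambda>i. euclidean) UNIV) ?P"
    unfolding compactin_PiE by (auto simp: compactin_euclidean_iff)
  then have "compact ?P"
    by (simp add: euclidean_product_topology compactin_euclidean_iff)
  moreover have "closed {g :: 'i \<Rightarrow> real. (\<Sum>i\<in>V. (g i)\<^sup>2) = 1}"
    by (intro closed_Collect_eq continuous_intros continuous_on_product_coordinates)
  ultimately have "compact (?P \<inter> {g. (\<Sum>i\<in>V. (g i)\<^sup>2) = 1})" by (rule compact_Int_closed)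
  also have "?P \<inter> {g. (\<Sum>i\<in>V. (g i)\<^sup>2) = 1} = ?K"
  proof (intro equalityI subsetI)
    fix g assume "g \<in> ?K"
    then have g: "\<forall>i. i \<notin> V \<longrightarrow> g i = 0" "(\<Sum>i\<in>V. (g i)\<^sup>2) = 1" by auto
    have "\<bar>g i\<bar> \<le> 1" if "i \<in> V" for i
    proof -
      have "(g i)\<^sup>2 \<le> (\<Sum>i\<in>V. (g i)\<^sup>2)"
        by (rule member_le_sum[OF that]) (use assms in auto)
      then show ?thesis using g by (simp add: abs_square_le_1)
    qed
    then show "g \<in> ?P \<inter> {g. (\<Sum>i\<in>V. (g i)\<^sup>2) = 1}"
      using g by (auto simp: abs_le_iff minus_le_iff)
  qed (auto simp: PiE_iff split: if_splits)
  finally show ?thesis .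
qed

text \<open>A maximizer of the quadratic form on the unit sphere is an eigenvector, and homogeneity
  extends its maximality to all vectors.\<close>

lemma symmetric_form_maximal_eigenvector:
  fixes a :: "'i \<Rightarrow> 'i \<Rightarrow> real"
  assumes fin: "finite V" and ne: "V \<noteq> {}" and sym: "\<And>i j. a i j = a j i"
  shows "\<exists>h \<mu>. (\<exists>i\<in>V. h i \<noteq> 0) \<and> (\<forall>i\<in>V. (\<Sum>j\<in>V. a i j * h j) = \<mu> * h i) \<and>
    (\<forall>g. (\<Sum>i\<in>V. \<Sum>j\<in>V. a i j * g i * g j) \<le> \<mu> * (\<Sum>i\<in>V. (g i)\<^sup>2))"
proof -
  define q where "q g = (\<Sum>i\<in>V. \<Sum>j\<in>V. a i j * g i * g j)" for g
  define s where "s g = (\<Sum>i\<in>V. (g i)\<^sup>2)" for g :: "'i \<Rightarrow> real"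
  define K where "K = {g. (\<forall>i. i \<notin> V \<longrightarrow> g i = 0) \<and> s g = 1}"
  have "compact K" unfolding K_def s_def by (rule compact_unit_sphere_fun[OF fin])
  moreover have "K \<noteq> {}"
  proof -
    obtain i where "i \<in> V" using ne by blast
    then have "(\<lambda>j. if j = i then 1 else 0) \<in> K"
      using fin by (auto simp: K_def s_def if_distrib[of "\<lambda>x. x\<^sup>2"] cong: if_cong)
    then show ?thesis by blast
  qed
  moreover have "continuous_on K q" unfolding q_def
    by (intro continuous_intros continuous_on_subset[OF continuous_on_product_coordinates subset_UNIV])
  ultimately obtain h where h: "h \<in> K" and max: "\<And>g. g \<in> K \<Longrightarrow> q g \<le> q h"
    using continuous_attains_sup by metis
  have sh: "s h = 1" using h by (simp add: K_def)
  have le: "q g \<le> q h * s g" for g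
  proof (cases "s g = 0")
    case True
    then have "g i = 0" if "i \<in> V" for i
      using that fin unfolding s_def by (subst (asm) sum_nonneg_eq_0_iff) auto
    then have "q g = 0" by (simp add: q_def)
    with True show ?thesis by simp
  next
    case False
    have pos: "0 < s g" using False by (simp add: s_def less_le sum_nonneg)
    define g' where "g' i = (if i \<in> V then g i / sqrt (s g) else 0)" for i
    have "s g' = (\<Sum>i\<in>V. (g i)\<^sup>2 / s g)"
      unfolding s_def[of g'] g'_def using pos by (intro sum.cong) (auto simp: power_divide)
    also have "\<dots> = 1" using False by (simp add: s_def sum_divide_distrib[symmetric])
    finally have "g' \<in> K" by (simp add: K_def g'_def)
    moreover have "q g' = q g / s g"
    proof -
      have "q g' = (\<Sum>i\<in>V. \<Sum>j\<in>V. a i j * g i * g j / s g)"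
        unfolding q_def g'_def using pos by (intro sum.cong) (auto simp: field_simps)
      then show ?thesis by (simp add: q_def sum_divide_distrib)
    qed
    ultimately have "q g / s g \<le> q h" using max[of g'] by simp
    then show ?thesis using pos by (simp only: pos_divide_le_eq)
  qed
  have eigen: "(\<Sum>j\<in>V. a i j * h j) = q h * h i" if i: "i \<in> V" for i
  proof -
    define b where "b = q h * h i - (\<Sum>j\<in>V. a i j * h j)"
    define c where "c = q h - a i i"
    have "0 \<le> 2 * t * b + t\<^sup>2 * c" for t
    proof -
      \<comment> \<open>Only coordinate i is perturbed; the first-order term of the nonnegative
        difference is then twice the defect in row i of the eigenvector equation.\<close>
      define e where "e j = (if j = i then t else 0)" for j
      have e: "(\<Sum>j\<in>V. f j * e j) = f i * t" "(\<Sum>j\<in>V. e j * f j) = t * f i" for f :: "'i \<Rightarrow> real"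
        unfolding e_def using fin i by (simp_all add: if_distrib if_distribR cong: if_cong)
      let ?g = "\<lambda>j. h j + e j"
      have "s ?g = s h + 2 * (\<Sum>j\<in>V. h j * e j) + (\<Sum>j\<in>V. e j * e j)"
        unfolding s_def by (simp add: power2_eq_square algebra_simps sum.distrib sum_distrib_left)
      also have "\<dots> = 1 + 2 * t * h i + t\<^sup>2"
        unfolding e sh by (simp add: e_def power2_eq_square)
      finally have s: "s ?g = 1 + 2 * t * h i + t\<^sup>2" .
      let ?r = "\<lambda>i. \<Sum>j\<in>V. a i j * h j"
      have "q ?g = (\<Sum>i\<in>V. h i * ?r i + h i * (\<Sum>j\<in>V. a i j * e j) + e i * ?r i + e i * (\<Sum>j\<in>V. a i j * e j))"
        unfolding q_def by (intro sum.cong refl) (simp add: algebra_simps sum.distrib sum_distrib_left)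
      also have "\<dots> = (\<Sum>i\<in>V. h i * ?r i) + (\<Sum>j\<in>V. h j * (a j i * t)) + t * ?r i + t * (a i i * t)"
        unfolding sum.distrib e ..
      also have "(\<Sum>i\<in>V. h i * ?r i) = q h"
        unfolding q_def by (simp add: sum_distrib_left mult_ac)
      also have "(\<Sum>j\<in>V. h j * (a j i * t)) = t * ?r i"
        unfolding sum_distrib_left by (intro sum.cong refl) (simp add: sym[of i])
      finally have "q ?g = q h + 2 * t * ?r i + t\<^sup>2 * a i i" by (simp add: power2_eq_square)
      with le[of ?g] s show ?thesis by (simp add: b_def c_def algebra_simps)
    qed
    from linear_coeff_zero_if_quadratic_nonneg[OF this] show ?thesis by (simp add: b_def)
  qed
  have "\<exists>i\<in>V. h i \<noteq> 0"
  proof (rule ccontr)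
    assume "\<not> ?thesis"
    then have "s h = 0" by (simp add: s_def)
    with sh show False by simp
  qed
  with eigen le show ?thesis unfolding q_def s_def by (intro exI[of _ h] exI) blast
qed

section \<open>From the adjacency matrix to functions on the vertices\<close>

lemma vertex_enum:
  assumes "finite (verts G)"
  shows "distinct (vertex_enum G)" "set (vertex_enum G) = verts G"
  using someI_ex[of "\<lambda>vs. distinct vs \<and> set vs = verts G"] finite_distinct_list[OF assms]
  by (auto simp: vertex_enum_def)

text \<open>Describes the spectrum without reference to the arbitrarily chosen enumeration of the
  vertices.\<close>

lemma spectrum_adjacency_matrix:
  assumes fin: "finite (verts G)"
  shows "spectrum (adjacency_matrix G) = {\<mu>. \<exists>h. (\<exists>u\<in>verts G. h u \<noteq> 0) \<and>
     (\<forall>u\<in>verts G. (\<Sum>v\<in>verts G. of_bool (adjacent G u v) * h v) = \<mu> * h u)}"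
proof -
  define vs where "vs = vertex_enum G"
  define n where "n = length vs"
  define A where "A = adjacency_matrix G"
  have vs: "distinct vs" "set vs = verts G" using vertex_enum[OF fin] by (simp_all add: vs_def)
  have A: "A = mat n n (\<lambda>(i, j). of_bool (adjacent G (vs ! i) (vs ! j)))"
    unfolding A_def adjacency_matrix_def vs_def[symmetric] Let_def n_def
    by (intro arg_cong[where f = "mat _ _"]) (auto simp: fun_eq_iff)
  have bij: "bij_betw ((!) vs) {..<n} (verts G)" using bij_betw_nth[OF vs(1), of "{..<n}"] vs(2) by (simp add: n_def)
  have reindex: "(\<Sum>v\<in>verts G. f v) = (\<Sum>j = 0..<n. f (vs ! j))" for f :: "'a \<Rightarrow> real"
    using sum.reindex_bij_betw[OF bij, of f] by (simp add: atLeast0LessThan)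
  have verts: "(\<forall>u\<in>verts G. P u) \<longleftrightarrow> (\<forall>i<n. P (vs ! i))" for P
    using vs(2) by (auto simp: n_def in_set_conv_nth all_set_conv_all_nth[symmetric])
  have vertsE: "(\<exists>u\<in>verts G. P u) \<longleftrightarrow> (\<exists>i<n. P (vs ! i))" for P
    using verts[of "\<lambda>u. \<not> P u"] by blast
  have mult: "(A *\<^sub>v x) $ i = (\<Sum>j = 0..<n. of_bool (adjacent G (vs ! i) (vs ! j)) * x $ j)"
    if "i < n" "x \<in> carrier_vec n" for i x
    using that by (simp add: A scalar_prod_def)
  have "eigenvalue A \<mu> \<longleftrightarrow> (\<exists>h. (\<exists>u\<in>verts G. h u \<noteq> 0) \<and>
     (\<forall>u\<in>verts G. (\<Sum>v\<in>verts G. of_bool (adjacent G u v) * h v) = \<mu> * h u))" for \<mu>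
  proof
    assume "eigenvalue A \<mu>"
    then obtain x where x: "x \<in> carrier_vec n" "x \<noteq> 0\<^sub>v n" "A *\<^sub>v x = \<mu> \<cdot>\<^sub>v x"
      by (auto simp: eigenvalue_def eigenvector_def A)
    define h where "h u = x $ (the_inv_into {..<n} ((!) vs) u)" for u
    have h: "h (vs ! i) = x $ i" if "i < n" for i
      using that the_inv_into_f_f[OF bij_betw_imp_inj_on[OF bij]] by (simp add: h_def)
    have "\<exists>i<n. x $ i \<noteq> 0" using x(1,2) by (auto simp: vec_eq_iff)
    then have 1: "\<exists>u\<in>verts G. h u \<noteq> 0" unfolding vertsE using h by auto
    have 2: "\<forall>u\<in>verts G. (\<Sum>v\<in>verts G. of_bool (adjacent G u v) * h v) = \<mu> * h u"
      unfolding verts reindex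
    proof (intro allI impI)
      fix i assume i: "i < n"
      have "(\<Sum>j = 0..<n. of_bool (adjacent G (vs ! i) (vs ! j)) * h (vs ! j)) = (A *\<^sub>v x) $ i"
        unfolding mult[OF i x(1)] using h by (intro sum.cong) auto
      also have "\<dots> = \<mu> * h (vs ! i)" unfolding x(3) using x(1) i h by simp
      finally show "(\<Sum>j = 0..<n. of_bool (adjacent G (vs ! i) (vs ! j)) * h (vs ! j)) = \<mu> * h (vs ! i)" .
    qed
    show "\<exists>h. (\<exists>u\<in>verts G. h u \<noteq> 0) \<and>
       (\<forall>u\<in>verts G. (\<Sum>v\<in>verts G. of_bool (adjacent G u v) * h v) = \<mu> * h u)"
      using 1 2 by blast
  next
    assume "\<exists>h. (\<exists>u\<in>verts G. h u \<noteq> 0) \<and>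
       (\<forall>u\<in>verts G. (\<Sum>v\<in>verts G. of_bool (adjacent G u v) * h v) = \<mu> * h u)"
    then obtain h where "\<exists>u\<in>verts G. h u \<noteq> 0"
      "\<forall>u\<in>verts G. (\<Sum>v\<in>verts G. of_bool (adjacent G u v) * h v) = \<mu> * h u" by blast
    then have h: "\<exists>i<n. h (vs ! i) \<noteq> 0"
      "\<forall>i<n. (\<Sum>j = 0..<n. of_bool (adjacent G (vs ! i) (vs ! j)) * h (vs ! j)) = \<mu> * h (vs ! i)"
      unfolding verts vertsE reindex by auto
    define x where "x = vec n (\<lambda>i. h (vs ! i))"
    have x: "x \<in> carrier_vec n" by (simp add: x_def)
    have "A *\<^sub>v x = \<mu> \<cdot>\<^sub>v x"
    proof (rule eq_vecI)
      fix i assume "i < dim_vec (\<mu> \<cdot>\<^sub>v x)"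
      then have i: "i < n" by (simp add: x_def)
      show "(A *\<^sub>v x) $ i = (\<mu> \<cdot>\<^sub>v x) $ i" unfolding mult[OF i x] using h(2) i by (simp add: x_def)
    qed (simp add: A x_def)
    moreover have "x \<noteq> 0\<^sub>v n" using h(1) by (auto simp: x_def vec_eq_iff)
    ultimately have "eigenvector A x \<mu>" using x by (simp add: eigenvector_def A)
    then show "eigenvalue A \<mu>" unfolding eigenvalue_def by blast
  qed
  then show ?thesis unfolding spectrum_def A_def by auto
qed

lemma adjacent_commute: "adjacent G u v \<longleftrightarrow> adjacent G v u"
  by (simp add: adjacent_def insert_commute)

text \<open>The value attained by the maximizing eigenvector lies in the finite spectrum, hence
  below its maximum; so the maximum exists as an eigenvalue and bounds the quadratic form.\<close>

lemma
  assumes fin: "finite (verts G)" and ne: "verts G \<noteq> {}"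
  shows graph_spectral_radius_eigenvector: "\<exists>h. (\<exists>u\<in>verts G. h u \<noteq> 0) \<and>
     (\<forall>u\<in>verts G. (\<Sum>v\<in>verts G. of_bool (adjacent G u v) * h v) = graph_spectral_radius G * h u)"
    and graph_rayleigh: "(\<Sum>u\<in>verts G. \<Sum>v\<in>verts G. of_bool (adjacent G u v) * g u * g v)
       \<le> graph_spectral_radius G * (\<Sum>u\<in>verts G. (g u)\<^sup>2)"
proof -
  let ?\<Lambda> = "spectrum (adjacency_matrix G)"
  note spec = spectrum_adjacency_matrix[OF fin]
  have "adjacency_matrix G \<in> carrier_mat (length (vertex_enum G)) (length (vertex_enum G))"
    by (simp add: adjacency_matrix_def Let_def)
  then have finS: "finite ?\<Lambda>" by (rule card_finite_spectrum)
  have sym: "of_bool (adjacent G u v) = (of_bool (adjacent G v u) :: real)" for u v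
    using adjacent_commute[of G u v] by simp
  from symmetric_form_maximal_eigenvector[where a = "\<lambda>u v. of_bool (adjacent G u v)", OF fin ne sym]
  obtain h :: "'a \<Rightarrow> real" and \<mu> where h: "\<exists>u\<in>verts G. h u \<noteq> 0"
      "\<forall>u\<in>verts G. (\<Sum>v\<in>verts G. of_bool (adjacent G u v) * h v) = \<mu> * h u"
    and le: "\<forall>g. (\<Sum>u\<in>verts G. \<Sum>v\<in>verts G. of_bool (adjacent G u v) * g u * g v) \<le> \<mu> * (\<Sum>u\<in>verts G. (g u)\<^sup>2)"
    by (elim exE conjE) (rule that)
  from h(1) h(2) have \<mu>: "\<mu> \<in> ?\<Lambda>" unfolding spec by blast
  then have "graph_spectral_radius G \<in> ?\<Lambda>"
    unfolding graph_spectral_radius_def using finS by (intro Max_in) auto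
  then show "\<exists>h. (\<exists>u\<in>verts G. h u \<noteq> 0) \<and>
     (\<forall>u\<in>verts G. (\<Sum>v\<in>verts G. of_bool (adjacent G u v) * h v) = graph_spectral_radius G * h u)"
    unfolding spec by blast
  have "\<mu> \<le> graph_spectral_radius G"
    unfolding graph_spectral_radius_def using finS \<mu> by simp
  then show "(\<Sum>u\<in>verts G. \<Sum>v\<in>verts G. of_bool (adjacent G u v) * g u * g v)
       \<le> graph_spectral_radius G * (\<Sum>u\<in>verts G. (g u)\<^sup>2)"
    by (intro order_trans[OF le[rule_format]] mult_right_mono sum_nonneg) auto
qed

text \<open>Apply the Rayleigh bound to f and g glued together; the symmetric double sum meets each
  edge twice, which explains the factor 2.\<close>

lemma bipartite_rayleigh:
  assumes G: "bipartite_graph G" and ne: "verts G \<noteq> {}"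
  shows "2 * (\<Sum>x\<in>partX G. \<Sum>y\<in>partY G. of_bool (adjacent G x y) * f x * g y)
    \<le> graph_spectral_radius G * ((\<Sum>x\<in>partX G. (f x)\<^sup>2) + (\<Sum>y\<in>partY G. (g y)\<^sup>2))"
proof -
  define X Y where "X = partX G" and "Y = partY G"
  have XY: "finite X" "finite Y" "X \<inter> Y = {}" "verts G = X \<union> Y"
    using G by (auto simp: bipartite_graph_def X_def Y_def verts_def)
  have fin: "finite (verts G)" using XY by simp
  define h where "h v = (if v \<in> X then f v else g v)" for v
  have h: "h x = f x" if "x \<in> X" for x using that by (simp add: h_def)
  have h': "h y = g y" if "y \<in> Y" for y using that XY by (auto simp: h_def)
  have no: "\<not> adjacent G u v" if "u \<in> X \<and> v \<in> X \<or> u \<in> Y \<and> v \<in> Y" for u v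
  proof
    assume "adjacent G u v"
    then have "{u, v} \<in> all_cross X Y"
      using G by (auto simp: bipartite_graph_def adjacent_def X_def Y_def)
    then show False using that XY(3) by (auto simp: all_cross_def doubleton_eq_iff)
  qed
  let ?a = "\<lambda>u v. of_bool (adjacent G u v) :: real"
  have "(\<Sum>u\<in>X. \<Sum>v\<in>X \<union> Y. ?a u v * h u * h v) = (\<Sum>x\<in>X. \<Sum>y\<in>Y. ?a x y * f x * g y)"
    by (rule sum.cong[OF refl]) (use XY no in \<open>simp add: sum.union_disjoint h h'\<close>)
  moreover have "(\<Sum>u\<in>Y. \<Sum>v\<in>X \<union> Y. ?a u v * h u * h v) = (\<Sum>y\<in>Y. \<Sum>x\<in>X. ?a x y * f x * g y)"
    by (rule sum.cong[OF refl])
      (use XY no in \<open>simp add: sum.union_disjoint h h' adjacent_commute[of G] mult_ac\<close>)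
  moreover have "(\<Sum>y\<in>Y. \<Sum>x\<in>X. ?a x y * f x * g y) = (\<Sum>x\<in>X. \<Sum>y\<in>Y. ?a x y * f x * g y)"
    by (rule sum.swap)
  ultimately have "(\<Sum>u\<in>verts G. \<Sum>v\<in>verts G. ?a u v * h u * h v) = 2 * (\<Sum>x\<in>X. \<Sum>y\<in>Y. ?a x y * f x * g y)"
    unfolding XY(4) using XY(1-3) by (simp add: sum.union_disjoint)
  moreover have "(\<Sum>u\<in>verts G. (h u)\<^sup>2) = (\<Sum>x\<in>X. (f x)\<^sup>2) + (\<Sum>y\<in>Y. (g y)\<^sup>2)"
    unfolding XY(4) using XY(1-3) by (simp add: sum.union_disjoint h h')
  ultimately show ?thesis using graph_rayleigh[OF fin ne, of h] unfolding X_def Y_def by simp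
qed

text \<open>If \<rho> > 0, an eigenvector for \<rho> is constant on A and on B and zero elsewhere.
  Its sums a and b over A and B satisfy \<rho> a = |A| b and \<rho> b = |B| a, whence \<rho>^2 =
  |A||B|.\<close>

lemma graph_spectral_radius_complete_le:
  assumes fin: "finite (verts G)" and ne: "verts G \<noteq> {}"
    and AB: "A \<subseteq> verts G" "B \<subseteq> verts G" "A \<inter> B = {}"
    and adj: "\<And>u v. u \<in> verts G \<Longrightarrow> v \<in> verts G \<Longrightarrow> adjacent G u v \<longleftrightarrow> u \<in> A \<and> v \<in> B \<or> u \<in> B \<and> v \<in> A"
  shows "graph_spectral_radius G \<le> sqrt (real (card A * card B))"
proof (cases "graph_spectral_radius G \<le> 0")
  case True
  then show ?thesis by (rule order_trans) simp
next
  case False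
  define \<rho> where "\<rho> = graph_spectral_radius G"
  obtain h u where u: "u \<in> verts G" "h u \<noteq> 0"
    and h: "\<And>u. u \<in> verts G \<Longrightarrow> (\<Sum>v\<in>verts G. of_bool (adjacent G u v) * h v) = \<rho> * h u"
    using graph_spectral_radius_eigenvector[OF fin ne] unfolding \<rho>_def by blast
  have pos: "0 < \<rho>" using False by (simp add: \<rho>_def)
  define a b where "a = sum h A" and "b = sum h B"
  have restr: "(\<Sum>v\<in>verts G. of_bool (v \<in> C) * h v) = sum h C" if "C \<subseteq> verts G" for C
    using that fin by (intro sum.mono_neutral_cong_right) auto
  have nb: "\<rho> * h u = (if u \<in> A then b else if u \<in> B then a else 0)" if "u \<in> verts G" for u
  proof -
    have "\<rho> * h u = (\<Sum>v\<in>verts G. of_bool (if u \<in> A then v \<in> B else if u \<in> B then v \<in> A else False) * h v)"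
      unfolding h[OF that, symmetric] using adj[OF that] AB by (intro sum.cong) auto
    then show ?thesis using restr AB(1,2) by (simp add: a_def b_def split: if_splits)
  qed
  have "\<rho> * a = card A * b"
    unfolding a_def sum_distrib_left using nb AB by (simp add: subset_iff)
  moreover have "\<rho> * b = card B * a"
  proof -
    have "\<rho> * h u = a" if "u \<in> B" for u
    proof -
      have "u \<in> verts G" "u \<notin> A" using AB that by blast+
      then show ?thesis using nb[of u] that by simp
    qed
    then have "\<rho> * b = (\<Sum>v\<in>B. a)" unfolding b_def sum_distrib_left by (intro sum.cong) auto
    then show ?thesis by simp
  qed
  moreover have "a \<noteq> 0 \<or> b \<noteq> 0" using nb[OF u(1)] u(2) pos by (auto split: if_splits)
  moreover have "\<rho>\<^sup>2 * a = \<rho> * (\<rho> * a)" "\<rho>\<^sup>2 * b = \<rho> * (\<rho> * b)"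
    by (simp_all add: power2_eq_square)
  ultimately have "\<rho>\<^sup>2 * a = real (card A * card B) * a \<and> \<rho>\<^sup>2 * b = real (card A * card B) * b"
    "a \<noteq> 0 \<or> b \<noteq> 0"
    by (simp_all add: mult.left_commute)
  then have "\<rho>\<^sup>2 = real (card A * card B)" by auto
  then have "\<rho> = sqrt (real (card A * card B))" using pos by (intro real_sqrt_unique[symmetric]) simp_all
  then show ?thesis by (simp add: \<rho>_def)
qed

section \<open>Nearly balanced bipartite graphs\<close>

lemma quasi_complement_simps [simp]:
  "partX (quasi_complement G) = partX G" "partY (quasi_complement G) = partY G"
  "verts (quasi_complement G) = verts G"
  by (simp_all add: quasi_complement_def verts_def)

lemma bipartite_quasi_complement:
  "bipartite_graph G \<Longrightarrow> bipartite_graph (quasi_complement G)"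
  by (auto simp: bipartite_graph_def quasi_complement_def)

lemma all_cross_doubleton:
  "{u, v} \<in> all_cross A B \<longleftrightarrow> u \<in> A \<and> v \<in> B \<or> u \<in> B \<and> v \<in> A"
  by (auto simp: all_cross_def doubleton_eq_iff)

lemma adjacent_quasi_complement:
  "adjacent (quasi_complement G) u v \<longleftrightarrow>
     (u \<in> partX G \<and> v \<in> partY G \<or> u \<in> partY G \<and> v \<in> partX G) \<and> \<not> adjacent G u v"
  by (auto simp: adjacent_def quasi_complement_def all_cross_doubleton)

lemma adjacent_parts:
  assumes "bipartite_graph G" "adjacent G u v"
  shows "u \<in> partX G \<and> v \<in> partY G \<or> u \<in> partY G \<and> v \<in> partX G"
  using assms by (auto simp: bipartite_graph_def adjacent_def all_cross_doubleton[symmetric])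

lemma bip_join_simps [simp]:
  "partX (bip_join G H) = Inl ` partX G \<union> Inr ` partX H"
  "partY (bip_join G H) = Inl ` partY G \<union> Inr ` partY H"
  by (simp_all add: bip_join_def)

lemma adjacent_bip_join [simp]:
  "adjacent (bip_join G H) (Inl u) (Inl v) \<longleftrightarrow> adjacent G u v"
  "adjacent (bip_join G H) (Inr u') (Inr v') \<longleftrightarrow> adjacent H u' v'"
  "adjacent (bip_join G H) (Inl u) (Inr v') \<longleftrightarrow> u \<in> partX G \<and> v' \<in> partY H \<or> u \<in> partY G \<and> v' \<in> partX H"
  "adjacent (bip_join G H) (Inr v') (Inl u) \<longleftrightarrow> u \<in> partX G \<and> v' \<in> partY H \<or> u \<in> partY G \<and> v' \<in> partX H"
proof -
  have l: "{Inl u, Inl v} = Inl ` e \<longleftrightarrow> e = {u, v}" for e :: "'a set" and u v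
    using inj_image_eq_iff[of Inl "{u, v}" e] by auto
  have r: "{Inr u, Inr v} = Inr ` e \<longleftrightarrow> e = {u, v}" for e :: "'b set" and u v
    using inj_image_eq_iff[of Inr "{u, v}" e] by auto
  have no: "{Inl u, w} \<noteq> Inr ` e" "{w, Inl u} \<noteq> Inr ` e" "{Inr v, w} \<noteq> Inl ` e'" "{w, Inr v} \<noteq> Inl ` e'"
    for u :: 'a and v :: 'b and w e e' by blast+
  show "adjacent (bip_join G H) (Inl u) (Inl v) \<longleftrightarrow> adjacent G u v"
    by (auto simp: adjacent_def bip_join_def all_cross_doubleton image_iff l no)
  show "adjacent (bip_join G H) (Inr u') (Inr v') \<longleftrightarrow> adjacent H u' v'"
    by (auto simp: adjacent_def bip_join_def all_cross_doubleton image_iff r no)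
  show *: "adjacent (bip_join G H) (Inl u) (Inr v') \<longleftrightarrow> u \<in> partX G \<and> v' \<in> partY H \<or> u \<in> partY G \<and> v' \<in> partX H"
    by (auto simp: adjacent_def bip_join_def all_cross_doubleton image_iff no)
  then show "adjacent (bip_join G H) (Inr v') (Inl u) \<longleftrightarrow> u \<in> partX G \<and> v' \<in> partY H \<or> u \<in> partY G \<and> v' \<in> partX H"
    by (simp add: adjacent_commute)
qed

lemma standard_bigraph_parts [simp]:
  "partX (complete_bigraph m n) = {..<m}" "partY (complete_bigraph m n) = {m..<m + n}"
  "partX (edgeless_bigraph m n) = {..<m}" "partY (edgeless_bigraph m n) = {m..<m + n}"
  by (simp_all add: complete_bigraph_def edgeless_bigraph_def)

lemma adjacent_complete_bigraph:
  "adjacent (complete_bigraph m n) u v \<longleftrightarrow> u < m \<and> m \<le> v \<and> v < m + n \<or> v < m \<and> m \<le> u \<and> u < m + n"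
  by (auto simp: adjacent_def complete_bigraph_def all_cross_doubleton)

lemma adjacent_edgeless_bigraph: "\<not> adjacent (edgeless_bigraph m n) u v"
  by (simp add: adjacent_def edgeless_bigraph_def)

text \<open>In the quasi-complement the complete part and all join edges disappear, leaving a
  complete bipartite graph on the edgeless part together with isolated vertices.\<close>

lemma spectral_radius_complete_join_edgeless_le:
  assumes "0 < a + b + c + d"
  shows "graph_spectral_radius (quasi_complement (bip_join (complete_bigraph a b) (edgeless_bigraph c d)))
    \<le> sqrt (real (c * d))"
proof -
  let ?J = "bip_join (complete_bigraph a b) (edgeless_bigraph c d)"
  let ?A = "Inr ` {..<c} :: (nat + nat) set" and ?B = "Inr ` {c..<c + d} :: (nat + nat) set"
  have verts: "verts ?J = Inl ` {..<a + b} \<union> Inr ` {..<c + d}"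
    by (auto simp: verts_def image_iff)
  have "card ?A = c" "card ?B = d" by (simp_all add: card_image)
  then have "graph_spectral_radius (quasi_complement ?J) \<le> sqrt (real (card ?A * card ?B)) \<Longrightarrow> ?thesis"
    by simp
  moreover have "graph_spectral_radius (quasi_complement ?J) \<le> sqrt (real (card ?A * card ?B))"
  proof (rule graph_spectral_radius_complete_le)
    show "finite (verts (quasi_complement ?J))" by (simp add: verts)
    show "verts (quasi_complement ?J) \<noteq> {}" using assms by (auto simp: verts lessThan_empty_iff)
    show "?A \<subseteq> verts (quasi_complement ?J)" "?B \<subseteq> verts (quasi_complement ?J)" by (auto simp: verts)
    show "?A \<inter> ?B = {}" by auto
    fix u v assume "u \<in> verts (quasi_complement ?J)" "v \<in> verts (quasi_complement ?J)"
    then show "adjacent (quasi_complement ?J) u v \<longleftrightarrow> u \<in> ?A \<and> v \<in> ?B \<or> u \<in> ?B \<and> v \<in> ?A"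
      unfolding adjacent_quasi_complement verts quasi_complement_simps
      by (cases u; cases v)
        (auto simp: adjacent_complete_bigraph adjacent_edgeless_bigraph image_iff)
  qed
  ultimately show ?thesis by simp
qed

lemma traceableI:
  assumes \<xi>: "bij_betw \<xi> {..<Suc m} P" and \<eta>: "bij_betw \<eta> {..<m} Q"
    and PQ: "verts G = P \<union> Q" "P \<inter> Q = {}"
    and adj: "\<And>i. i < m \<Longrightarrow> adjacent G (\<xi> i) (\<eta> i)" "\<And>i. i < m \<Longrightarrow> adjacent G (\<xi> (Suc i)) (\<eta> i)"
  shows "traceable G"
proof -
  define w where "w j = (if even j then \<xi> (j div 2) else \<eta> (j div 2))" for j
  define p where "p = map w [0..<2 * m + 1]"
  have range: "w j \<in> (if even j then P else Q)" if "j < 2 * m + 1" for j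
  proof -
    have "j div 2 < Suc m" "odd j \<Longrightarrow> j div 2 < m" using that by (auto elim!: oddE)
    then show ?thesis using \<xi> \<eta> by (auto simp: w_def bij_betw_def)
  qed
  have "inj_on w {0..<2 * m + 1}"
  proof (rule inj_onI)
    fix i j assume ij: "i \<in> {0..<2 * m + 1}" "j \<in> {0..<2 * m + 1}" "w i = w j"
    have par: "even i \<longleftrightarrow> even j" using range[of i] range[of j] ij PQ(2) by (auto split: if_splits)
    have "i div 2 = j div 2"
    proof (cases "even i")
      case True
      then have "\<xi> (i div 2) = \<xi> (j div 2)" using ij(3) par by (simp add: w_def)
      then show ?thesis using \<xi> ij by (auto simp: bij_betw_def dest!: inj_onD)
    next
      case False
      then have "\<eta> (i div 2) = \<eta> (j div 2)" using ij(3) par by (simp add: w_def)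
      moreover have "i div 2 < m" "j div 2 < m" using False par ij by (auto elim!: oddE)
      ultimately show ?thesis using \<eta> by (auto simp: bij_betw_def dest!: inj_onD)
    qed
    then show "i = j" using par by (metis bit_eq_rec even_iff_mod_2_eq_zero odd_iff_mod_2_eq_one div_mult_mod_eq)
  qed
  then have "distinct p" unfolding p_def distinct_map by (simp del: upt_Suc)
  moreover have "set p = verts G"
  proof (intro equalityI subsetI)
    fix v assume "v \<in> set p"
    then obtain j where "j < 2 * m + 1" "v = w j" by (auto simp: p_def simp del: upt_Suc)
    then show "v \<in> verts G" using range[of j] PQ(1) by (auto split: if_splits)
  next
    fix v assume "v \<in> verts G"
    then consider "v \<in> P" | "v \<in> Q" using PQ by blast
    then show "v \<in> set p"
    proof cases
      case 1
      then obtain i where "i < Suc m" "v = \<xi> i" using \<xi> by (auto simp: bij_betw_def)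
      then have "2 * i < 2 * m + 1" "v = w (2 * i)" by (simp_all add: w_def)
      then show ?thesis unfolding p_def by (auto simp del: upt_Suc)
    next
      case 2
      then obtain i where "i < m" "v = \<eta> i" using \<eta> by (auto simp: bij_betw_def)
      then have "2 * i + 1 < 2 * m + 1" "v = w (2 * i + 1)" by (simp_all add: w_def)
      then show ?thesis unfolding p_def by (auto simp del: upt_Suc)
    qed
  qed
  moreover have "successively (adjacent G) p"
    unfolding successively_conv_nth
  proof (intro allI impI)
    fix j assume "Suc j < length p"
    then have j: "Suc j < 2 * m + 1" by (simp add: p_def)
    have "adjacent G (w j) (w (Suc j))"
    proof (cases "even j")
      case True
      then obtain i where "j = 2 * i" by (auto elim: evenE)
      then show ?thesis using adj(1)[of i] j by (simp add: w_def)
    next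
      case False
      then obtain i where "j = 2 * i + 1" by (auto elim: oddE)
      then show ?thesis using adj(2)[of i] j by (simp add: w_def adjacent_commute[of G "\<eta> i"])
    qed
    then show "adjacent G (p ! j) (p ! Suc j)" using j by (simp add: p_def del: upt_Suc)
  qed
  ultimately show ?thesis unfolding traceable_def by blast
qed

section \<open>Balancing by a dominating vertex\<close>

text \<open>The added vertex \<^term>\<open>None\<close> balances the two parts and is joined to the whole larger part, so
  that Hamilton cycles of the new graph are Hamilton paths of the old one.\<close>

definition dominated_edges :: "'a bigraph \<Rightarrow> 'a set \<Rightarrow> 'a set \<Rightarrow> ('a \<times> 'a option) set" where
  "dominated_edges G P Q = {(x, w). x \<in> P \<and> (w = None \<or> (\<exists>y\<in>Q. w = Some y \<and> adjacent G x y))}"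

lemma traceable_if_hamiltonian:
  assumes PQ: "verts G = P \<union> Q" "P \<inter> Q = {}" and n: "0 < n"
    and ham: "hamiltonian n P (insert None (Some ` Q)) (dominated_edges G P Q)"
  shows "traceable G"
proof -
  let ?E = "dominated_edges G P Q" and ?Y = "insert None (Some ` Q)"
  obtain \<xi>0 \<eta>0 where p0: "ham_path n P ?Y ?E \<xi>0 \<eta>0" "(\<xi>0 0, \<eta>0 (n - 1)) \<in> ?E"
    using ham by (auto simp: hamiltonian_def)
  then obtain m where m: "m < n" "None = \<eta>0 m"
    unfolding ham_path_def bij_betw_def by (metis imageE insertI1 lessThan_iff)
  \<comment> \<open>The cycle is turned so that \<open>None\<close> comes last; cutting it off
    leaves a path that starts and ends in P.\<close>
  obtain \<xi> \<eta> where p: "ham_path n P ?Y ?E \<xi> \<eta>" and last: "\<eta> (n - 1) = None"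
    using ham_cycle_edge_closing[OF p0, of "\<xi>0 m" None] m by blast
  have b: "bij_betw \<xi> {..<n} P" "bij_betw \<eta> {..<n} ?Y"
    and E: "\<And>i. i < n \<Longrightarrow> (\<xi> i, \<eta> i) \<in> ?E" "\<And>i. Suc i < n \<Longrightarrow> (\<xi> (Suc i), \<eta> i) \<in> ?E"
    using p by (auto simp: ham_path_def)
  obtain k where k: "n = Suc k" using n gr0_implies_Suc by blast
  have "bij_betw \<eta> ({..<n} - {n - 1}) (?Y - {None})"
    using bij_betw_DiffI[OF b(2), of "{n - 1}" "{None}"] last n by (simp add: bij_betw_def)
  moreover have "{..<n} - {n - 1} = {..<k}" "?Y - {None} = Some ` Q" using k by auto
  ultimately have \<eta>: "bij_betw \<eta> {..<k} (Some ` Q)" by simp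
  have "bij_betw the (Some ` Q) Q" by (auto simp: bij_betw_def inj_on_def image_image)
  with \<eta> have \<eta>': "bij_betw (the \<circ> \<eta>) {..<k} Q" by (rule bij_betw_trans)
  have some: "\<eta> i \<noteq> None" if "i < k" for i using \<eta> that by (auto simp: bij_betw_def)
  show ?thesis
  proof (rule traceableI[OF b(1)[unfolded k] \<eta>' PQ])
    fix i assume i: "i < k"
    show "adjacent G (\<xi> i) ((the \<circ> \<eta>) i)" using E(1)[of i] some[OF i] i k by (auto simp: dominated_edges_def)
    show "adjacent G (\<xi> (Suc i)) ((the \<circ> \<eta>) i)" using E(2)[of i] some[OF i] i k by (auto simp: dominated_edges_def)
  qed
qed

text \<open>Fixes which part plays the role of P, so that the interchange of the parts is dealt with
  once; P becomes the larger part in the applications.\<close>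

locale oriented_bipartite =
  fixes G :: "'a bigraph" and P Q :: "'a set"
  assumes bip: "bipartite_graph G"
    and orient: "P = partX G \<and> Q = partY G \<or> P = partY G \<and> Q = partX G"
begin

lemma parts: "finite P" "finite Q" "P \<inter> Q = {}" "verts G = P \<union> Q"
  using bip orient by (auto simp: bipartite_graph_def verts_def)

lemma not_adjacent: "u \<in> P \<and> v \<in> P \<or> u \<in> Q \<and> v \<in> Q \<Longrightarrow> \<not> adjacent G u v"
  using adjacent_parts[OF bip, of u v] orient parts(3) by auto

lemma vertex_degree:
  "x \<in> P \<Longrightarrow> vertex_degree G x = card {y \<in> Q. adjacent G x y}"
  "y \<in> Q \<Longrightarrow> vertex_degree G y = card {x \<in> P. adjacent G x y}"
  using not_adjacent unfolding vertex_degree_def parts(4)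
  by (auto intro!: arg_cong[where f = card] simp: adjacent_commute[of G y])

text \<open>The new vertex is adjacent to all of P, so the complement of the balanced graph is the
  quasi-complement of G with one isolated vertex added, which keeps the bound.\<close>

lemma form_bounded_dominated:
  assumes \<theta>: "graph_spectral_radius (quasi_complement G) \<le> \<theta>" "0 \<le> \<theta>" and ne: "verts G \<noteq> {}"
  shows "form_bounded P (insert None (Some ` Q))
    (P \<times> insert None (Some ` Q) - dominated_edges G P Q) \<theta>"
proof -
  define D where "D A B = {(x, y). x \<in> A \<and> y \<in> B \<and> \<not> adjacent G x y}" for A B
  have XY: "form_bounded (partX G) (partY G) (D (partX G) (partY G)) \<theta>"
    unfolding form_bounded_def
  proof (intro allI)
    fix f g :: "'a \<Rightarrow> real"
    have fin: "finite (partX G)" "finite (partY G)" using bip by (auto simp: bipartite_graph_def)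
    have "(\<Sum>(x, y)\<in>D (partX G) (partY G). f x * g y)
      = (\<Sum>(x, y)\<in>partX G \<times> partY G. of_bool (adjacent (quasi_complement G) x y) * f x * g y)"
      using fin by (intro sum.mono_neutral_cong_left) (auto simp: D_def adjacent_quasi_complement)
    also have "\<dots> = (\<Sum>x\<in>partX G. \<Sum>y\<in>partY G. of_bool (adjacent (quasi_complement G) x y) * f x * g y)"
      by (simp add: sum.cartesian_product)
    finally have "2 * (\<Sum>(x, y)\<in>D (partX G) (partY G). f x * g y)
      \<le> graph_spectral_radius (quasi_complement G) * ((\<Sum>x\<in>partX G. (f x)\<^sup>2) + (\<Sum>y\<in>partY G. (g y)\<^sup>2))"
      using bipartite_rayleigh[OF bipartite_quasi_complement[OF bip], of f g] ne by simp
    also have "\<dots> \<le> \<theta> * ((\<Sum>x\<in>partX G. (f x)\<^sup>2) + (\<Sum>y\<in>partY G. (g y)\<^sup>2))"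
      using \<theta> by (intro mult_right_mono add_nonneg_nonneg sum_nonneg) auto
    finally show "2 * (\<Sum>(x, y)\<in>D (partX G) (partY G). f x * g y)
      \<le> \<theta> * ((\<Sum>x\<in>partX G. (f x)\<^sup>2) + (\<Sum>y\<in>partY G. (g y)\<^sup>2))" .
  qed
  have "(D (partX G) (partY G))\<inverse> = D (partY G) (partX G)"
    by (auto simp: D_def adjacent_commute)
  then have "form_bounded (partY G) (partX G) (D (partY G) (partX G)) \<theta>"
    using form_bounded_converse[OF XY] by simp
  with XY orient have PQ: "form_bounded P Q (D P Q) \<theta>" by auto
  show ?thesis
    unfolding form_bounded_def
  proof (intro allI)
    fix f :: "'a \<Rightarrow> real" and g :: "'a option \<Rightarrow> real"
    have "P \<times> insert None (Some ` Q) - dominated_edges G P Q = (\<lambda>(x, y). (x, Some y)) ` D P Q"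
      by (auto simp: D_def dominated_edges_def)
    moreover have "inj_on (\<lambda>(x, y). (x, Some y)) (D P Q)" by (auto simp: inj_on_def)
    ultimately have "2 * (\<Sum>(x, w)\<in>P \<times> insert None (Some ` Q) - dominated_edges G P Q. f x * g w)
      = 2 * (\<Sum>(x, y)\<in>D P Q. f x * g (Some y))"
      by (simp add: sum.reindex case_prod_unfold)
    also have "\<dots> \<le> \<theta> * ((\<Sum>x\<in>P. (f x)\<^sup>2) + (\<Sum>y\<in>Q. (g (Some y))\<^sup>2))"
      by (rule form_boundedD[OF PQ])
    also have "(\<Sum>y\<in>Q. (g (Some y))\<^sup>2) = (\<Sum>w\<in>Some ` Q. (g w)\<^sup>2)"
      by (simp add: sum.reindex)
    also have "\<theta> * ((\<Sum>x\<in>P. (f x)\<^sup>2) + (\<Sum>w\<in>Some ` Q. (g w)\<^sup>2))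
      \<le> \<theta> * ((\<Sum>x\<in>P. (f x)\<^sup>2) + (\<Sum>w\<in>insert None (Some ` Q). (g w)\<^sup>2))"
      using \<theta>(2) parts(2) by (intro mult_left_mono) auto
    finally show "2 * (\<Sum>(x, w)\<in>P \<times> insert None (Some ` Q) - dominated_edges G P Q. f x * g w)
      \<le> \<theta> * ((\<Sum>x\<in>P. (f x)\<^sup>2) + (\<Sum>w\<in>insert None (Some ` Q). (g w)\<^sup>2))" .
  qed
qed

text \<open>The isomorphism sends Q to the first part of the join, because \<open>S_family\<close>
  and \<open>T_graph n 0\<close> list the smaller part first. The graph H is a relabelled copy of
  what remains of G outside the block.\<close>

lemma isomorphic_bip_join:
  assumes TS: "T \<subseteq> P" "S \<subseteq> Q"
    and adj: "\<And>x y. x \<in> P \<Longrightarrow> y \<in> Q \<Longrightarrow> x \<in> T \<Longrightarrow> y \<in> S \<Longrightarrow> \<not> adjacent G x y"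
      "\<And>x y. x \<in> P \<Longrightarrow> y \<in> Q \<Longrightarrow> (x \<in> T) \<noteq> (y \<in> S) \<Longrightarrow> adjacent G x y"
    and a: "a = card (Q - S)" and b: "b = card (P - T)"
  obtains H where "bipartite_graph H" "partX H = {..<a}" "partY H = {a..<a + b}"
    "isomorphic G (bip_join H (edgeless_bigraph (card S) (card T)))"
proof -
  define s t where "s = card S" and "t = card T"
  have fin: "finite (Q - S)" "finite (P - T)" "finite S" "finite T"
    using parts TS finite_subset by auto
  have "card (Q - S) = card {..<a}" using a by simp
  then obtain \<alpha> where \<alpha>: "bij_betw \<alpha> (Q - S) {..<a}"
    using finite_same_card_bij[OF fin(1)] by blast
  have "card (P - T) = card {a..<a + b}" using b by simp
  then obtain \<beta> where \<beta>: "bij_betw \<beta> (P - T) {a..<a + b}"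
    using finite_same_card_bij[OF fin(2)] by blast
  have "card S = card {..<s}" using s_def by simp
  then obtain \<gamma> where \<gamma>: "bij_betw \<gamma> S {..<s}"
    using finite_same_card_bij[OF fin(3)] by blast
  have "card T = card {s..<s + t}" using t_def by simp
  then obtain \<delta> where \<delta>: "bij_betw \<delta> T {s..<s + t}"
    using finite_same_card_bij[OF fin(4)] by blast
  define H where "H = \<lparr>partX = {..<a}, partY = {a..<a + b},
    edges = {{\<alpha> y, \<beta> x} | x y. x \<in> P - T \<and> y \<in> Q - S \<and> adjacent G x y}\<rparr>"
  define J where "J = bip_join H (edgeless_bigraph s t)"
  define f :: "'a \<Rightarrow> nat + nat" where "f v = (if v \<in> S then Inr (\<gamma> v) else if v \<in> T then Inr (\<delta> v)
    else if v \<in> Q then Inl (\<alpha> v) else Inl (\<beta> v))" for v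
  have H: "partX H = {..<a}" "partY H = {a..<a + b}" by (simp_all add: H_def)
  have im: "\<alpha> ` (Q - S) = {..<a}" "\<beta> ` (P - T) = {a..<a + b}" "\<gamma> ` S = {..<s}" "\<delta> ` T = {s..<s + t}"
    using \<alpha> \<beta> \<gamma> \<delta> by (simp_all add: bij_betw_def)
  have disj: "x \<notin> Q" if "x \<in> P" for x using parts(3) that by blast
  have f: "f y = Inl (\<alpha> y)" if "y \<in> Q - S" for y
    using that disj TS by (auto simp: f_def)
  have f': "f x = Inl (\<beta> x)" if "x \<in> P - T" for x
    using that disj TS by (auto simp: f_def)
  have f'': "f y = Inr (\<gamma> y)" if "y \<in> S" for y using that by (simp add: f_def)
  have f''': "f x = Inr (\<delta> x)" if "x \<in> T" for x using that disj TS by (auto simp: f_def)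
  have Q: "f ` Q = partX J"
  proof -
    have "f ` Q = f ` (Q - S) \<union> f ` S" using TS by blast
    also have "f ` (Q - S) = Inl ` \<alpha> ` (Q - S)" using f by (simp add: image_image)
    also have "f ` S = Inr ` \<gamma> ` S" using f'' by (simp add: image_image)
    finally show ?thesis unfolding im by (simp add: J_def H)
  qed
  have P: "f ` P = partY J"
  proof -
    have "f ` P = f ` (P - T) \<union> f ` T" using TS by blast
    also have "f ` (P - T) = Inl ` \<beta> ` (P - T)" using f' by (simp add: image_image)
    also have "f ` T = Inr ` \<delta> ` T" using f''' by (simp add: image_image)
    finally show ?thesis unfolding im by (simp add: J_def H)
  qed
  have mem: "\<alpha> y < a" if "y \<in> Q - S" for y using im(1) that by blast
  have mem': "a \<le> \<beta> x" "\<beta> x < a + b" if "x \<in> P - T" for x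
    using im(2) that atLeastLessThan_iff by blast+
  have bipH: "bipartite_graph H"
    using mem mem' by (auto simp: bipartite_graph_def H_def all_cross_doubleton)
  \<comment> \<open>Injectivity by counting: the image exhausts the join, which has as many vertices
    as G.\<close>
  have "inj_on f (verts G)"
  proof (rule eq_card_imp_inj_on)
    show "finite (verts G)" using parts by simp
    have "card (f ` verts G) = card (partX J \<union> partY J)"
      unfolding parts(4) image_Un P Q by (simp add: Un_commute)
    also have "\<dots> = card (Inl ` {..<a + b} \<union> Inr ` {..<s + t} :: (nat + nat) set)"
      by (intro arg_cong[where f = card]) (auto simp: J_def H image_iff)
    also have "\<dots> = (a + b) + (s + t)" by (subst card_Un_disjoint) (auto simp: card_image)
    also have "\<dots> = card P + card Q"
      using a b card_Diff_subset[OF fin(3) TS(2)] card_Diff_subset[OF fin(4) TS(1)]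
        card_mono[OF parts(1) TS(1)] card_mono[OF parts(2) TS(2)] by (simp add: s_def t_def)
    also have "\<dots> = card (verts G)" unfolding parts(4) using parts(1-3) by (simp add: card_Un_disjoint)
    finally show "card (f ` verts G) = card (verts G)" .
  qed
  moreover have "f ` verts G = verts J"
    unfolding parts(4) image_Un P Q by (auto simp: verts_def)
  ultimately have bij: "bij_betw f (verts G) (verts J)" by (simp add: bij_betw_def)
  have adjPQ: "adjacent J (f x) (f y) \<longleftrightarrow> adjacent G x y" if xy: "x \<in> P" "y \<in> Q" for x y
  proof -
    consider "x \<in> T" "y \<in> S" | "x \<in> T" "y \<in> Q - S" | "x \<in> P - T" "y \<in> S" | "x \<in> P - T" "y \<in> Q - S"
      using xy by blast
    then show ?thesis
    proof cases
      case 1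
      then show ?thesis using adj(1)[OF xy] by (simp add: f'' f''' J_def adjacent_edgeless_bigraph)
    next
      case 2
      then have "\<alpha> y \<in> {..<a}" "\<delta> x \<in> {s..<s + t}" unfolding im[symmetric] by blast+
      then show ?thesis using 2 adj(2)[OF xy] by (simp add: f f''' J_def H)
    next
      case 3
      then have "\<gamma> y \<in> {..<s}" "\<beta> x \<in> {a..<a + b}" unfolding im[symmetric] by blast+
      then show ?thesis using 3 adj(2)[OF xy] by (simp add: f' f'' J_def H)
    next
      case 4
      have "adjacent H (\<beta> x) (\<alpha> y) \<longleftrightarrow> adjacent G x y"
      proof
        assume "adjacent H (\<beta> x) (\<alpha> y)"
        then obtain x' y' where e: "{\<beta> x, \<alpha> y} = {\<alpha> y', \<beta> x'}" and m: "x' \<in> P - T" "y' \<in> Q - S"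
          and g: "adjacent G x' y'"
          unfolding adjacent_def H_def by auto
        \<comment> \<open>The labels \<alpha> lie below a and the labels \<beta> do not, so the
          unordered pair determines which end is which.\<close>
        have "\<beta> x = \<beta> x'" "\<alpha> y = \<alpha> y'"
          using e mem[OF 4(2)] mem[OF m(2)] mem'[OF 4(1)] mem'[OF m(1)]
          by (auto simp: doubleton_eq_iff)
        then have "x = x'" "y = y'"
          using inj_onD[OF bij_betw_imp_inj_on[OF \<beta>]] inj_onD[OF bij_betw_imp_inj_on[OF \<alpha>]] 4 m by blast+
        then show "adjacent G x y" using g by simp
      next
        assume "adjacent G x y"
        then show "adjacent H (\<beta> x) (\<alpha> y)"
          using 4 unfolding adjacent_def H_def by (auto simp: insert_commute)
      qed
      then show ?thesis using 4 by (simp add: f f' J_def)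
    qed
  qed
  have bipJ: "\<not> adjacent J u v" if "u \<in> partX J \<and> v \<in> partX J \<or> u \<in> partY J \<and> v \<in> partY J" for u v
    using that
    by (cases u; cases v) (auto simp: J_def H adjacent_edgeless_bigraph dest!: adjacent_parts[OF bipH])
  have "\<forall>u\<in>verts G. \<forall>v\<in>verts G. adjacent G u v \<longleftrightarrow> adjacent J (f u) (f v)"
  proof (intro ballI)
    fix u v assume "u \<in> verts G" "v \<in> verts G"
    then consider "u \<in> P" "v \<in> Q" | "u \<in> Q" "v \<in> P" | "u \<in> P \<and> v \<in> P \<or> u \<in> Q \<and> v \<in> Q"
      unfolding parts(4) by blast
    then show "adjacent G u v \<longleftrightarrow> adjacent J (f u) (f v)"
    proof cases
      case 1
      then show ?thesis using adjPQ by simp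
    next
      case 2
      then show ?thesis using adjPQ[of v u] by (simp add: adjacent_commute)
    next
      case 3
      then have "f u \<in> partX J \<and> f v \<in> partX J \<or> f u \<in> partY J \<and> f v \<in> partY J"
        unfolding P[symmetric] Q[symmetric] by blast
      then show ?thesis using bipJ not_adjacent[OF 3] by blast
    qed
  qed
  moreover have "f ` partX G = partX J \<and> f ` partY G = partY J \<or> f ` partX G = partY J \<and> f ` partY G = partX J"
    using P Q orient by blast
  ultimately have "isomorphic G J"
    unfolding isomorphic_def using bij by blast
  then show ?thesis using that[OF bipH H] by (simp add: J_def s_def t_def)
qed

lemma isomorphic_if_block:
  assumes T: "T \<subseteq> P" "T \<noteq> {}" and S: "S \<subseteq> insert None (Some ` Q)"
    and block: "\<forall>x\<in>P. \<forall>w\<in>insert None (Some ` Q).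
      (x \<in> T \<and> w \<in> S \<longrightarrow> (x, w) \<notin> dominated_edges G P Q) \<and>
      ((x \<in> T) \<noteq> (w \<in> S) \<longrightarrow> (x, w) \<in> dominated_edges G P Q)"
    and a: "a = card Q - card S" and b: "b = card P - card T"
  obtains H where "bipartite_graph H" "partX H = {..<a}" "partY H = {a..<a + b}"
    "isomorphic G (bip_join H (edgeless_bigraph (card S) (card T)))"
proof -
  define S' where "S' = {y \<in> Q. Some y \<in> S}"
  \<comment> \<open>\<open>None\<close> is adjacent to every vertex of the nonempty set T, so it
    cannot belong to a block of nonadjacent pairs.\<close>
  have "None \<notin> S" using T block by (force simp: dominated_edges_def)
  then have "S = Some ` S'" using S by (auto simp: S'_def)
  then have cardS: "card S' = card S" by (simp add: card_image)
  have S': "S' \<subseteq> Q" by (auto simp: S'_def)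
  have fin: "finite S'" "finite T"
    using finite_subset[OF S' parts(2)] finite_subset[OF T(1) parts(1)] .
  have adj: "(x \<in> T \<and> y \<in> S' \<longrightarrow> \<not> adjacent G x y) \<and> ((x \<in> T) \<noteq> (y \<in> S') \<longrightarrow> adjacent G x y)"
    if "x \<in> P" "y \<in> Q" for x y
  proof -
    have "(x, Some y) \<in> dominated_edges G P Q \<longleftrightarrow> adjacent G x y" "y \<in> S' \<longleftrightarrow> Some y \<in> S"
      using that by (auto simp: dominated_edges_def S'_def)
    then show ?thesis using block that by blast
  qed
  have ab: "a = card (Q - S')" "b = card (P - T)"
    using card_Diff_subset[OF fin(1) S'] card_Diff_subset[OF fin(2) T(1)] a b cardS by simp_all
  note result = that
  show ?thesis
  proof (rule isomorphic_bip_join[OF T(1) S' _ _ ab])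
    show "\<not> adjacent G x y" if "x \<in> P" "y \<in> Q" "x \<in> T" "y \<in> S'" for x y
      using adj that by blast
    show "adjacent G x y" if "x \<in> P" "y \<in> Q" "(x \<in> T) \<noteq> (y \<in> S')" for x y
      using adj[OF that(1,2)] that(3) by blast
  qed (rule result, simp_all only: cardS)
qed

lemma card_dominated:
  assumes "card P = n" "card Q = n - 1" "0 < n"
  shows "card (insert None (Some ` Q)) = n"
  using assms parts(2) by (simp add: card_image)

lemma dominated_degrees:
  "x \<in> P \<Longrightarrow> card {w \<in> insert None (Some ` Q). (x, w) \<in> dominated_edges G P Q} = vertex_degree G x + 1"
  "w \<in> insert None (Some ` Q) \<Longrightarrow> card {x \<in> P. (x, w) \<in> dominated_edges G P Q}
    = (case w of None \<Rightarrow> card P | Some y \<Rightarrow> vertex_degree G y)"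
proof -
  assume x: "x \<in> P"
  then have "{w \<in> insert None (Some ` Q). (x, w) \<in> dominated_edges G P Q}
    = insert None (Some ` {y \<in> Q. adjacent G x y})"
    by (auto simp: dominated_edges_def)
  then show "card {w \<in> insert None (Some ` Q). (x, w) \<in> dominated_edges G P Q} = vertex_degree G x + 1"
    using parts(2) by (simp add: card_image vertex_degree(1)[OF x])
next
  assume w: "w \<in> insert None (Some ` Q)"
  show "card {x \<in> P. (x, w) \<in> dominated_edges G P Q}
    = (case w of None \<Rightarrow> card P | Some y \<Rightarrow> vertex_degree G y)"
  proof (cases w)
    case None
    then show ?thesis by (auto simp: dominated_edges_def)
  next
    case (Some y)
    then have "y \<in> Q" using w by auto
    then have "{x \<in> P. (x, w) \<in> dominated_edges G P Q} = {x \<in> P. adjacent G x y}"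
      using Some by (auto simp: dominated_edges_def)
    then show ?thesis using Some vertex_degree(2)[OF \<open>y \<in> Q\<close>] by simp
  qed
qed

lemma nontraceable_in_S_family:
  assumes card: "card P = n" "card Q = n - 1" and k: "1 \<le> k" "2 * k + 1 \<le> n"
    and deg: "\<forall>v\<in>verts G. k \<le> vertex_degree G v"
    and \<rho>: "graph_spectral_radius (quasi_complement G) \<le> sqrt (real (k * (n - k)))"
    and nt: "\<not> traceable G"
  shows "in_family G (S_family n k)"
proof -
  let ?Y = "insert None (Some ` Q)" and ?E = "dominated_edges G P Q"
  have n: "0 < n" using k by simp
  have E: "?E \<subseteq> P \<times> ?Y" by (auto simp: dominated_edges_def)
  have nh: "\<not> hamiltonian n P ?Y ?E" using traceable_if_hamiltonian[OF parts(4,3) n] nt by blast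
  have fin: "finite P" "finite ?Y" using parts by auto
  have ne: "verts G \<noteq> {}" using card n parts by auto
  have deg1: "\<forall>x\<in>P. k + 1 \<le> card {w \<in> ?Y. (x, w) \<in> ?E}"
    using deg dominated_degrees(1) by (simp add: parts(4))
  have deg2: "\<forall>w\<in>?Y. k \<le> card {x \<in> P. (x, w) \<in> ?E}"
    using deg dominated_degrees(2) k by (auto simp: parts(4) card split: option.split)
  obtain T S where TS: "T \<subseteq> P" "S \<subseteq> ?Y" "card T = n - k" "card S = k"
    "\<forall>x\<in>P. \<forall>w\<in>?Y. (x \<in> T \<and> w \<in> S \<longrightarrow> (x, w) \<notin> ?E) \<and> ((x \<in> T) \<noteq> (w \<in> S) \<longrightarrow> (x, w) \<in> ?E)"
    by (rule nonhamiltonian_extremal[OF fin card(1) card_dominated[OF card n] k E nh deg1 deg2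
          form_bounded_dominated[OF \<rho> _ ne]]) simp_all
  have "T \<noteq> {}" using TS(3) k by auto
  have "n - k - 1 = card Q - card S" "k = card P - card T" using TS(3,4) card k by auto
  from isomorphic_if_block[OF TS(1) \<open>T \<noteq> {}\<close> TS(2,5) this]
  obtain H where H: "bipartite_graph H" "partX H = {..<n - k - 1}" "partY H = {n - k - 1..<n - k - 1 + k}"
    "isomorphic G (bip_join H (edgeless_bigraph (card S) (card T)))" .
  then have "H \<in> bigraphs (n - k - 1) k" by (simp add: bigraphs_def)
  then have "bip_join H (edgeless_bigraph k (n - k)) \<in> S_family n k"
    using k unfolding S_family_def by blast
  then show ?thesis using H(4) TS(3,4) unfolding in_family_def by auto
qed

lemma nontraceable_in_S_family_or_T_graph:
  assumes card: "card P = n" "card Q = n - 1" and n: "2 \<le> n"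
    and \<rho>: "graph_spectral_radius (quasi_complement G) \<le> sqrt (real (n - 1))"
    and nt: "\<not> traceable G"
  shows "in_family G (S_family n 1 \<union> {T_graph n 0})"
proof -
  let ?Y = "insert None (Some ` Q)" and ?E = "dominated_edges G P Q"
  have n': "0 < n" using n by simp
  have E: "?E \<subseteq> P \<times> ?Y" by (auto simp: dominated_edges_def)
  have nh: "\<not> hamiltonian n P ?Y ?E" using traceable_if_hamiltonian[OF parts(4,3) n'] nt by blast
  have fin: "finite P" "finite ?Y" using parts by auto
  have ne: "verts G \<noteq> {}" using card n parts by auto
  have deg: "\<forall>x\<in>P. 1 \<le> card {w \<in> ?Y. (x, w) \<in> ?E}" using dominated_degrees(1) by simp
  obtain T S where TS: "T \<subseteq> P" "S \<subseteq> ?Y" "card T = n - 1 \<and> card S = 1 \<or> card T = 1 \<and> card S = n - 1"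
    "\<forall>x\<in>P. \<forall>w\<in>?Y. (x \<in> T \<and> w \<in> S \<longrightarrow> (x, w) \<notin> ?E) \<and> ((x \<in> T) \<noteq> (w \<in> S) \<longrightarrow> (x, w) \<in> ?E)"
    by (rule nonhamiltonian_extremal_degree_zero[OF fin card(1) card_dominated[OF card n'] n E nh deg
          form_bounded_dominated[OF \<rho> _ ne]]) simp_all
  have "T \<noteq> {}" using TS(3) n by auto
  note iso = isomorphic_if_block[OF TS(1) \<open>T \<noteq> {}\<close> TS(2,4)]
  \<comment> \<open>For n = 2 the two alternatives coincide; that case is assigned to
    \<open>T_graph n 0\<close>, as \<open>S_family n 1\<close> is empty there.\<close>
  consider "card T = n - 1" "card S = 1" "3 \<le> n" | "card T = 1" "card S = n - 1"
    using TS(3) n by linarith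
  then show ?thesis
  proof cases
    case 1
    then have "n - 1 - 1 = card Q - card S" "1 = card P - card T" using card by auto
    from iso[OF this]
    obtain H where H: "bipartite_graph H" "partX H = {..<n - 1 - 1}" "partY H = {n - 1 - 1..<n - 1 - 1 + 1}"
      "isomorphic G (bip_join H (edgeless_bigraph (card S) (card T)))" .
    then have "H \<in> bigraphs (n - 1 - 1) 1" by (simp add: bigraphs_def)
    moreover have "2 * 1 + 1 \<le> n" using 1(3) by simp
    ultimately have "bip_join H (edgeless_bigraph 1 (n - 1)) \<in> S_family n 1"
      unfolding S_family_def by blast
    then show ?thesis using H(4) 1 unfolding in_family_def by auto
  next
    case 2
    then have "0 = card Q - card S" "n - 1 = card P - card T" using card by auto
    from iso[OF this]
    obtain H where H: "bipartite_graph H" "partX H = {..<0}" "partY H = {0..<0 + (n - 1)}"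
      "isomorphic G (bip_join H (edgeless_bigraph (card S) (card T)))" .
    \<comment> \<open>The block uses up all of Q, so H has an empty first part and is the degenerate
      complete graph occurring in \<open>T_graph n 0\<close>.\<close>
    have "edges H = {}" using H(1,2) by (auto simp: bipartite_graph_def all_cross_def)
    then have "H = complete_bigraph 0 (n - 1)"
      using H(2,3) by (intro bigraph.equality) (auto simp: complete_bigraph_def all_cross_def)
    then have "isomorphic G (T_graph n 0)" using H(4) 2 by (simp add: T_graph_def)
    then show ?thesis unfolding in_family_def by blast
  qed
qed

end

theorem theorem2p7:
  fixes G :: "'a bigraph" and n k :: nat
  assumes "2 * k + 1 \<le> n"
    and "bipartite_graph G"
    and "nearly_balanced G"
    and "card (verts G) = 2 * n - 1"
    and "k \<le> min_degree G"
  shows "(1 \<le> k \<and>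
           graph_spectral_radius (quasi_complement G)
             \<le> graph_spectral_radius (quasi_complement (S_graph n k)) \<longrightarrow>
           \<not> in_family G (S_family n k) \<longrightarrow> traceable G) \<and>
         (k = 0 \<and> 2 \<le> n \<and>
           graph_spectral_radius (quasi_complement G)
             \<le> graph_spectral_radius (quasi_complement (T_graph n 0)) \<longrightarrow>
           \<not> in_family G (S_family n 1 \<union> {T_graph n 0}) \<longrightarrow> traceable G)"
proof -
  have "card (partX G) + card (partY G) = 2 * n - 1"
    using assms(2,4) by (simp add: bipartite_graph_def verts_def card_Un_disjoint)
  then have "card (partX G) = n \<and> card (partY G) = n - 1 \<or> card (partY G) = n \<and> card (partX G) = n - 1"
    using assms(1,3) unfolding nearly_balanced_def by linarith
  then obtain P Q where PQ: "P = partX G \<and> Q = partY G \<or> P = partY G \<and> Q = partX G"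
    and card: "card P = n" "card Q = n - 1" by blast
  interpret oriented_bipartite G P Q using assms(2) PQ by unfold_locales
  have deg: "\<forall>v\<in>verts G. k \<le> vertex_degree G v"
  proof
    fix v assume "v \<in> verts G"
    then have "min_degree G \<le> vertex_degree G v"
      unfolding min_degree_def using parts by (intro Min_le) auto
    then show "k \<le> vertex_degree G v" using assms(5) by simp
  qed
  show ?thesis
  proof (intro conjI impI)
    assume "1 \<le> k \<and> graph_spectral_radius (quasi_complement G)
      \<le> graph_spectral_radius (quasi_complement (S_graph n k))" and "\<not> in_family G (S_family n k)"
    \<comment> \<open>Only this upper bound on the radius of the comparison graph enters: it turns
      the hypothesis on G into the numerical bound sqrt(c).\<close>
    moreover have "graph_spectral_radius (quasi_complement (S_graph n k)) \<le> sqrt (real (k * (n - k)))"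
      using spectral_radius_complete_join_edgeless_le[of k "n - k - 1" "n - k" k] assms(1)
      by (simp add: S_graph_def mult.commute)
    ultimately show "traceable G"
      using nontraceable_in_S_family[OF card _ assms(1) deg] by (meson order_trans)
  next
    assume "k = 0 \<and> 2 \<le> n \<and> graph_spectral_radius (quasi_complement G)
      \<le> graph_spectral_radius (quasi_complement (T_graph n 0))"
      and "\<not> in_family G (S_family n 1 \<union> {T_graph n 0})"
    moreover have "graph_spectral_radius (quasi_complement (T_graph n 0)) \<le> sqrt (real (n - 1))"
      using spectral_radius_complete_join_edgeless_le[of 0 "n - 1" "n - 1" 1]
      by (simp add: T_graph_def)
    ultimately show "traceable G"
      using nontraceable_in_S_family_or_T_graph[OF card] by (meson order_trans)
  qed
qed

end
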